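(* Let $X,Y\in\{0,1\}$ be binary random variables with joint distribution $P_{X,Y}$. Let $Z_1=X+Y\in\{0,1,2\}$ (integer sum), $Z_2=X\oplus Y$ (XOR), and $Z_3=X\wedge Y$ (AND). Then: (1) For any $P_{X,Y}$, $\Psi(X;Y\|Z_2)=I(X;Y)$. (2) If $\operatorname{Cov}(X,Y)\le 0$, then $\Psi(X;Y\|Z_1)=\Psi(X;Y\|Z_3)=I(X;Y)$. (3) If $\operatorname{Cov}(X,Y)>0$, then $\Psi(X;Y\|Z_1)=\Psi(X;Y\|Z_3)=0$.
   Context: All random variables have finite alphabets. $I$ denotes Shannon (conditional) mutual information. For $(X,Y,Z)\sim P_{X,Y,Z}$, define $$\Psi(X;Y\|Z)\triangleq\inf_J\max_{(U,V)}\big[ I(X;Y|J)+I(U;J|V)-I(U;Z|V)\big],$$ where the infimum is over all finite-alphabet random variables $J$ jointly distributed with $(X,Y,Z)$ (the value depends only on $P_{J|X,Y}$ and $P_{X,Y,Z}$), and the maximum is over all finite-alphabet $(U,V)$ such that $(U,V)$ and $(J,Z)$ are conditionally independent given $(X,Y)$. *)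

theory Defs
  imports "HOL-Probability.Probability"
begin

text \<open>
  Random variables are functions on a sample space carrying a pmf. All information quantities are
  in bits. On countable value types the measure \<^term>\<open>count_space UNIV\<close> is sigma-finite and its
  products are again counting measures, so the generic library notions specialise to the usual
  discrete ones, also when the value type is infinite but only finitely many values have positive
  probability.
\<close>

definition mutual_info ::
    "'w pmf \<Rightarrow> ('w \<Rightarrow> 'a::countable) \<Rightarrow> ('w \<Rightarrow> 'b::countable) \<Rightarrow> real" where
  "mutual_info M X Y =
     prob_space.mutual_information (measure_pmf M) 2 (count_space UNIV) (count_space UNIV) X Y"

definition cond_mutual_info ::
    "'w pmf \<Rightarrow> ('w \<Rightarrow> 'a::countable) \<Rightarrow> ('w \<Rightarrow> 'b::countable) \<Rightarrow> ('w \<Rightarrow> 'c::countable) \<Rightarrow> real" where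
  "cond_mutual_info M X Y Z =
     prob_space.conditional_mutual_information (measure_pmf M) 2
       (count_space UNIV) (count_space UNIV) (count_space UNIV) X Y Z"

definition covariance :: "'w pmf \<Rightarrow> ('w \<Rightarrow> real) \<Rightarrow> ('w \<Rightarrow> real) \<Rightarrow> real" where
  "covariance M X Y =
     measure_pmf.expectation M
       (\<lambda>w. (X w - measure_pmf.expectation M X) * (Y w - measure_pmf.expectation M Y))"

text \<open>
  Conditional independence of \<open>A\<close> and \<open>B\<close> given \<open>C\<close>, with the conditional probabilities multiplied
  out, so that values of \<open>C\<close> of probability zero impose no constraint.
\<close>

definition cond_indep ::
    "'w pmf \<Rightarrow> ('w \<Rightarrow> 'a) \<Rightarrow> ('w \<Rightarrow> 'b) \<Rightarrow> ('w \<Rightarrow> 'c) \<Rightarrow> bool" where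
  "cond_indep M A B C \<longleftrightarrow>
     (\<forall>a b c. measure_pmf.prob M {w. A w = a \<and> B w = b \<and> C w = c} * measure_pmf.prob M {w. C w = c}
            = measure_pmf.prob M {w. A w = a \<and> C w = c} * measure_pmf.prob M {w. B w = b \<and> C w = c})"

text \<open>
  Every finite alphabet embeds into \<^typ>\<open>nat\<close> and all quantities below are invariant under
  relabelling, so the auxiliary variables \<open>J\<close>, \<open>U\<close>, \<open>V\<close> range over \<^typ>\<open>nat\<close>-valued variables with
  finitely many values. A choice of \<open>J\<close> is a joint law of \<open>(X, Y, Z, J)\<close> with the prescribed law of
  \<open>(X, Y, Z)\<close>; a choice of \<open>(U, V)\<close> is a joint law of \<open>(X, Y, Z, J, U, V)\<close> extending it.
\<close>

definition J_choices ::
    "('x \<times> 'y \<times> 'z) pmf \<Rightarrow> ('x \<times> 'y \<times> 'z \<times> nat) pmf set" where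
  "J_choices P =
     {Q. finite (set_pmf Q) \<and> map_pmf (\<lambda>(x, y, z, j). (x, y, z)) Q = P}"

definition UV_choices ::
    "('x \<times> 'y \<times> 'z \<times> nat) pmf \<Rightarrow> ('x \<times> 'y \<times> 'z \<times> nat \<times> nat \<times> nat) pmf set" where
  "UV_choices Q =
     {R. finite (set_pmf R)
       \<and> map_pmf (\<lambda>(x, y, z, j, u, v). (x, y, z, j)) R = Q
       \<and> cond_indep R (\<lambda>(x, y, z, j, u, v). (u, v))
                      (\<lambda>(x, y, z, j, u, v). (j, z))
                      (\<lambda>(x, y, z, j, u, v). (x, y))}"

text \<open>
  The maximum over \<open>(U, V)\<close> is rendered as a supremum, and both extrema are taken in the complete
  lattice \<^typ>\<open>ereal\<close>, so neither depends on a convention for unbounded or empty sets of reals.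
\<close>

definition Psi :: "('x::countable \<times> 'y::countable \<times> 'z::countable) pmf \<Rightarrow> ereal" where
  "Psi P =
     (INF Q \<in> J_choices P. SUP R \<in> UV_choices Q. ereal
        (  cond_mutual_info R (\<lambda>(x, y, z, j, u, v). x) (\<lambda>(x, y, z, j, u, v). y) (\<lambda>(x, y, z, j, u, v). j)
         + cond_mutual_info R (\<lambda>(x, y, z, j, u, v). u) (\<lambda>(x, y, z, j, u, v). j) (\<lambda>(x, y, z, j, u, v). v)
         - cond_mutual_info R (\<lambda>(x, y, z, j, u, v). u) (\<lambda>(x, y, z, j, u, v). z) (\<lambda>(x, y, z, j, u, v). v)))"

text \<open>The joint law of \<open>(X, Y, f(X, Y))\<close> when \<open>(X, Y)\<close> has law \<open>P\<close>.\<close>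

definition adjoin :: "('x \<Rightarrow> 'y \<Rightarrow> 'z) \<Rightarrow> ('x \<times> 'y) pmf \<Rightarrow> ('x \<times> 'y \<times> 'z) pmf" where
  "adjoin f P = map_pmf (\<lambda>(x, y). (x, y, f x y)) P"

end

theory Submission
  imports Defs
begin

text \<open>
  A constant \<open>J\<close> shows \<open>\<Psi> \<le> I(X;Y)\<close>. Conversely, let \<open>U\<close> be generated from \<open>(X, Y)\<close> such that
  \<open>X\<close> and \<open>Y\<close> are independent given \<open>U\<close> while \<open>U\<close> is independent of \<open>Z\<close>. With \<open>V\<close> constant the
  objective becomes \<open>I(X;Y|J) + I(U;J)\<close>, which is at least \<open>I(X;Y)\<close> for every \<open>J\<close>.

  When the covariance is nonpositive such a \<open>U\<close> exists for \<open>Z = X + Y\<close>: there are \<open>s\<close> and \<open>t\<close> such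
  that the sum of independent Bernoulli(\<open>s\<close>) and Bernoulli(\<open>t\<close>) variables has the law of \<open>Z\<close>, and
  the bit \<open>U\<close> decides which of the two is \<open>X\<close>; swapping them does not change the law of the sum.
  The same \<open>U\<close> serves every function of \<open>X + Y\<close>, in particular AND and XOR. For XOR a positive
  covariance is reduced to a negative one by complementing \<open>Y\<close>.

  When the covariance is positive, let \<open>J\<close> be AND with the value 1 erased to 0 with probability
  \<open>p\<^sub>0\<^sub>1 p\<^sub>1\<^sub>0 / (p\<^sub>0\<^sub>0 p\<^sub>1\<^sub>1)\<close>. This makes \<open>X\<close> and \<open>Y\<close> independent given \<open>J\<close>, and \<open>J\<close> is a degraded
  version of \<open>Z\<close>, so the objective is nonpositive by data processing.
\<close>

section \<open>Entropy of finitely supported variables\<close>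

text \<open>Written as an expected surprisal over the sample space, so the value type need not be
  countable and a combination of entropies is a single expectation.\<close>

definition H :: "'w pmf \<Rightarrow> ('w \<Rightarrow> 'a) \<Rightarrow> real" where
  "H M f = measure_pmf.expectation M (\<lambda>w. - log 2 (pmf (map_pmf f M) (f w)))"

lemma H_map_pmf: "H (map_pmf g M) f = H M (\<lambda>w. f (g w))"
  by (simp add: H_def map_pmf_comp)

text \<open>Entropy sees only the partition of the support into level sets. This covers regrouping
  of tuples and the removal of constant components.\<close>

lemma H_cong:
  assumes "\<And>w w'. w \<in> set_pmf M \<Longrightarrow> w' \<in> set_pmf M \<Longrightarrow> f w = f w' \<longleftrightarrow> g w = g w'"
  shows "H M f = H M g"
proof -
  have "pmf (map_pmf f M) (f w) = pmf (map_pmf g M) (g w)" if "w \<in> set_pmf M" for w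
    unfolding pmf_map
    by (rule measure_prob_cong_0) (use that assms in \<open>auto simp: set_pmf_iff\<close>)
  then show ?thesis
    unfolding H_def by (intro integral_cong_AE) (auto simp: AE_measure_pmf_iff)
qed

lemma H_const: "H M (\<lambda>_. c) = 0"
  by (simp add: H_def)

lemma pmf_map_pos: "w \<in> set_pmf M \<Longrightarrow> pmf (map_pmf f M) (f w) > 0"
  by (intro pmf_positive) auto

text \<open>With the four entropies merged into one expected log ratio, conditional independence
  shows up as a ratio equal to 1, and submodularity becomes an estimate of the ratio's mean.\<close>

lemma H_combination:
  assumes "finite (set_pmf M)"
  shows "H M f + H M g - H M h - H M k =
    measure_pmf.expectation M (\<lambda>w.
      log 2 (pmf (map_pmf h M) (h w) * pmf (map_pmf k M) (k w)
        / (pmf (map_pmf f M) (f w) * pmf (map_pmf g M) (g w))))"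
proof -
  have "H M f + H M g - H M h - H M k = measure_pmf.expectation M (\<lambda>w.
      - log 2 (pmf (map_pmf f M) (f w)) - log 2 (pmf (map_pmf g M) (g w))
      + log 2 (pmf (map_pmf h M) (h w)) + log 2 (pmf (map_pmf k M) (k w)))"
    unfolding H_def using assms by (simp add: integrable_measure_pmf_finite)
  also have "\<dots> = measure_pmf.expectation M (\<lambda>w.
      log 2 (pmf (map_pmf h M) (h w) * pmf (map_pmf k M) (k w)
        / (pmf (map_pmf f M) (f w) * pmf (map_pmf g M) (g w))))"
  proof (intro integral_cong_AE)
    show "AE w in measure_pmf M. - log 2 (pmf (map_pmf f M) (f w)) - log 2 (pmf (map_pmf g M) (g w))
      + log 2 (pmf (map_pmf h M) (h w)) + log 2 (pmf (map_pmf k M) (k w)) =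
      log 2 (pmf (map_pmf h M) (h w) * pmf (map_pmf k M) (k w)
        / (pmf (map_pmf f M) (f w) * pmf (map_pmf g M) (g w)))"
      unfolding AE_measure_pmf_iff
    proof
      fix w assume "w \<in> set_pmf M"
      note pos = pmf_map_pos[OF this, of f] pmf_map_pos[OF this, of g]
        pmf_map_pos[OF this, of h] pmf_map_pos[OF this, of k]
      show "- log 2 (pmf (map_pmf f M) (f w)) - log 2 (pmf (map_pmf g M) (g w))
        + log 2 (pmf (map_pmf h M) (h w)) + log 2 (pmf (map_pmf k M) (k w)) =
        log 2 (pmf (map_pmf h M) (h w) * pmf (map_pmf k M) (k w)
          / (pmf (map_pmf f M) (f w) * pmf (map_pmf g M) (g w)))"
        using pos by (simp add: log_mult log_divide)
    qed
  qed auto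
  finally show ?thesis .
qed

section \<open>Information quantities as combinations of entropies\<close>

lemma mutual_info_eq:
  fixes X :: "'w \<Rightarrow> 'a::countable" and Y :: "'w \<Rightarrow> 'b::countable"
  assumes fin: "finite (set_pmf M)"
  shows "mutual_info M X Y = H M X + H M Y - H M (\<lambda>w. (X w, Y w))"
proof -
  interpret information_space "measure_pmf M" 2
    by standard simp
  have cs: "count_space UNIV \<Otimes>\<^sub>M count_space UNIV = (count_space UNIV :: ('a \<times> 'b) measure)"
    by (subst pair_measure_countable) auto
  have dist: "distributed (measure_pmf M) (count_space UNIV) f (\<lambda>x. ennreal (pmf (map_pmf f M) x))"
    for f :: "'w \<Rightarrow> 'c"
    unfolding distributed_def by (simp add: measure_pmf_eq_density[symmetric] map_pmf_rep_eq)
  have "mutual_info M X Y = (\<integral>z. pmf (map_pmf (\<lambda>w. (X w, Y w)) M) z *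
      log 2 (pmf (map_pmf (\<lambda>w. (X w, Y w)) M) z
        / (pmf (map_pmf X M) (fst z) * pmf (map_pmf Y M) (snd z)))
      \<partial>(count_space UNIV \<Otimes>\<^sub>M count_space UNIV))"
    unfolding mutual_info_def
    by (rule mutual_information_distr)
       (auto simp: cs sigma_finite_measure_count_space intro!: dist)
  also have "\<dots> = measure_pmf.expectation (map_pmf (\<lambda>w. (X w, Y w)) M) (\<lambda>z.
      log 2 (pmf (map_pmf (\<lambda>w. (X w, Y w)) M) z
        / (pmf (map_pmf X M) (fst z) * pmf (map_pmf Y M) (snd z))))"
    unfolding cs measure_pmf_eq_density by (subst integral_density) auto
  \<comment> \<open>A constant variable, of entropy 0, fills the fourth slot of
    \<open>H_combination\<close>.\<close>
  also have "\<dots> = H M X + H M Y - H M (\<lambda>w. (X w, Y w)) - H M (\<lambda>_. ())"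
    by (simp add: H_combination[OF fin])
  finally show ?thesis by (simp add: H_const)
qed

lemma cond_mutual_info_eq:
  fixes X :: "'w \<Rightarrow> 'a::countable" and Y :: "'w \<Rightarrow> 'b::countable" and Z :: "'w \<Rightarrow> 'c::countable"
  assumes fin: "finite (set_pmf M)"
  shows "cond_mutual_info M X Y Z =
    H M (\<lambda>w. (X w, Z w)) + H M (\<lambda>w. (Y w, Z w)) - H M Z - H M (\<lambda>w. (X w, Y w, Z w))"
proof -
  have cs: "count_space UNIV \<Otimes>\<^sub>M count_space UNIV = (count_space UNIV :: ('b \<times> 'c) measure)"
    by (subst pair_measure_countable) auto
  \<comment> \<open>Conditional mutual information is defined through the chain rule, as I(X;Y,Z) -
    I(X;Z).\<close>
  have "cond_mutual_info M X Y Z = mutual_info M X (\<lambda>w. (Y w, Z w)) - mutual_info M X Z"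
    unfolding cond_mutual_info_def mutual_info_def
      prob_space.conditional_mutual_information_def[OF prob_space_measure_pmf] cs ..
  then show ?thesis by (simp add: mutual_info_eq[OF fin])
qed

lemma cond_indep_map:
  "cond_indep (map_pmf g M) A B C = cond_indep M (\<lambda>w. A (g w)) (\<lambda>w. B (g w)) (\<lambda>w. C (g w))"
  by (simp add: cond_indep_def vimage_def)

lemma H_cond_indep:
  assumes fin: "finite (set_pmf M)" and ci: "cond_indep M A B C"
  shows "H M (\<lambda>w. (A w, C w)) + H M (\<lambda>w. (B w, C w)) = H M C + H M (\<lambda>w. (A w, B w, C w))"
proof -
  have "H M (\<lambda>w. (A w, C w)) + H M (\<lambda>w. (B w, C w)) - H M C - H M (\<lambda>w. (A w, B w, C w))
    = measure_pmf.expectation M (\<lambda>w. 0)"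
    unfolding H_combination[OF fin]
  proof (intro integral_cong_AE)
    show "AE w in measure_pmf M. log 2 (pmf (map_pmf C M) (C w) *
        pmf (map_pmf (\<lambda>w. (A w, B w, C w)) M) (A w, B w, C w) /
        (pmf (map_pmf (\<lambda>w. (A w, C w)) M) (A w, C w) *
         pmf (map_pmf (\<lambda>w. (B w, C w)) M) (B w, C w))) = 0"
      unfolding AE_measure_pmf_iff
    proof
      fix w assume w: "w \<in> set_pmf M"
      have "pmf (map_pmf C M) (C w) * pmf (map_pmf (\<lambda>w. (A w, B w, C w)) M) (A w, B w, C w)
          = pmf (map_pmf (\<lambda>w. (A w, C w)) M) (A w, C w) *
            pmf (map_pmf (\<lambda>w. (B w, C w)) M) (B w, C w)"
        using ci[unfolded cond_indep_def, rule_format, of "A w" "B w" "C w"]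
        by (simp add: pmf_map vimage_def mult.commute)
      then show "log 2 (pmf (map_pmf C M) (C w) *
        pmf (map_pmf (\<lambda>w. (A w, B w, C w)) M) (A w, B w, C w) /
        (pmf (map_pmf (\<lambda>w. (A w, C w)) M) (A w, C w) *
         pmf (map_pmf (\<lambda>w. (B w, C w)) M) (B w, C w))) = 0"
        using pmf_map_pos[OF w, of "\<lambda>w. (A w, C w)"] pmf_map_pos[OF w, of "\<lambda>w. (B w, C w)"]
        by simp
    qed
  qed auto
  then show ?thesis by simp
qed

section \<open>Submodularity of entropy\<close>

lemma pair_singleton: "S \<times> {c} = (\<lambda>a. (a, c)) ` S"
  by auto

lemma sum_pmf_map_marginal:
  assumes "finite (set_pmf M)"
  shows "(\<Sum>a\<in>A ` set_pmf M. pmf (map_pmf (\<lambda>w. (A w, C w)) M) (a, c)) = pmf (map_pmf C M) c"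
proof -
  have "(\<Sum>a\<in>A ` set_pmf M. pmf (map_pmf (\<lambda>w. (A w, C w)) M) (a, c))
      = measure (map_pmf (\<lambda>w. (A w, C w)) M) (A ` set_pmf M \<times> {c})"
    using assms sum.reindex[of "\<lambda>a. (a, c)" "A ` set_pmf M" "pmf (map_pmf (\<lambda>w. (A w, C w)) M)"]
    by (subst measure_measure_pmf_finite) (auto simp: inj_on_def pair_singleton)
  also have "\<dots> = pmf (map_pmf C M) c"
    unfolding pmf_map measure_map_pmf
    by (rule measure_prob_cong_0) (auto simp: set_pmf_iff)
  finally show ?thesis .
qed

text \<open>This is I(A;B|C) \<ge> 0. The ratio p(a,c) p(b,c) / (p(c) p(a,b,c)) has mean at most 1,
  and log x is at most (x - 1) / ln 2 to base 2.\<close>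

lemma H_submodular:
  assumes fin: "finite (set_pmf M)"
  shows "H M C + H M (\<lambda>w. (A w, B w, C w)) \<le> H M (\<lambda>w. (A w, C w)) + H M (\<lambda>w. (B w, C w))"
proof -
  define p where "p = pmf (map_pmf (\<lambda>w. (A w, B w, C w)) M)"
  define pa where "pa = pmf (map_pmf (\<lambda>w. (A w, C w)) M)"
  define pb where "pb = pmf (map_pmf (\<lambda>w. (B w, C w)) M)"
  define pc where "pc = pmf (map_pmf C M)"
  define SA SB SC S where "SA = A ` set_pmf M" and "SB = B ` set_pmf M" and "SC = C ` set_pmf M"
    and "S = (\<lambda>w. (A w, B w, C w)) ` set_pmf M"
  have finS: "finite SA" "finite SB" "finite SC" "finite S"
    using fin by (auto simp: SA_def SB_def SC_def S_def)
  let ?t = "\<lambda>(a, b, c). pa (a, c) * pb (b, c) / (pc c * p (a, b, c))"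
  have "measure_pmf.expectation M (\<lambda>w. ?t (A w, B w, C w))
      = measure_pmf.expectation (map_pmf (\<lambda>w. (A w, B w, C w)) M) ?t"
    by simp
  also have "\<dots> = (\<Sum>s\<in>S. ?t s * p s)"
    using finS unfolding p_def
    by (subst integral_measure_pmf_real[where A = S]) (auto simp: S_def)
  also have "\<dots> = (\<Sum>(a, b, c)\<in>S. pa (a, c) * pb (b, c) / pc c)"
  proof (intro sum.cong refl)
    fix s assume "s \<in> S"
    then have "p s \<noteq> 0" by (auto simp: p_def S_def pmf_eq_0_set_pmf)
    then show "?t s * p s = (case s of (a, b, c) \<Rightarrow> pa (a, c) * pb (b, c) / pc c)"
      by (cases s) simp
  qed
  \<comment> \<open>The summand is nonnegative also off the support of the triple, so the sum may be
    extended to the full product, where it factors for each c.\<close>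
  also have "\<dots> \<le> (\<Sum>(a, b, c)\<in>SA \<times> SB \<times> SC. pa (a, c) * pb (b, c) / pc c)"
    using finS by (intro sum_mono2) (auto simp: S_def SA_def SB_def SC_def pa_def pb_def pc_def)
  also have "\<dots> = (\<Sum>a\<in>SA. \<Sum>b\<in>SB. \<Sum>c\<in>SC. pa (a, c) * pb (b, c) / pc c)"
    by (simp add: sum.cartesian_product)
  also have "\<dots> = (\<Sum>c\<in>SC. \<Sum>a\<in>SA. \<Sum>b\<in>SB. pa (a, c) * pb (b, c) / pc c)"
    by (subst sum.swap[where A = SB], subst sum.swap[where A = SA]) simp
  also have "\<dots> = (\<Sum>c\<in>SC. (\<Sum>a\<in>SA. pa (a, c)) * (\<Sum>b\<in>SB. pb (b, c)) / pc c)"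
    by (simp add: sum_product sum_divide_distrib)
  also have "\<dots> = (\<Sum>c\<in>SC. pc c)"
    unfolding SA_def SB_def pa_def pb_def pc_def
    by (simp add: sum_pmf_map_marginal[OF fin])
  also have "\<dots> = 1"
    unfolding pc_def using finS by (intro sum_pmf_eq_1) (auto simp: SC_def)
  finally have le1: "measure_pmf.expectation M (\<lambda>w. ?t (A w, B w, C w)) \<le> 1" .
  have "H M C + H M (\<lambda>w. (A w, B w, C w)) - H M (\<lambda>w. (A w, C w)) - H M (\<lambda>w. (B w, C w))
      = measure_pmf.expectation M (\<lambda>w. log 2 (?t (A w, B w, C w)))"
    unfolding H_combination[OF fin] p_def pa_def pb_def pc_def by simp
  also have "\<dots> \<le> measure_pmf.expectation M (\<lambda>w. (?t (A w, B w, C w) - 1) / ln 2)"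
  proof (intro integral_mono_AE integrable_measure_pmf_finite fin)
    show "AE w in measure_pmf M. log 2 (?t (A w, B w, C w)) \<le> (?t (A w, B w, C w) - 1) / ln 2"
      unfolding AE_measure_pmf_iff
    proof
      fix w assume w: "w \<in> set_pmf M"
      have "?t (A w, B w, C w) > 0"
        using pmf_map_pos[OF w, of "\<lambda>w. (A w, B w, C w)"] pmf_map_pos[OF w, of "\<lambda>w. (A w, C w)"]
          pmf_map_pos[OF w, of "\<lambda>w. (B w, C w)"] pmf_map_pos[OF w, of C]
        by (simp add: p_def pa_def pb_def pc_def)
      from ln_le_minus_one[OF this]
      show "log 2 (?t (A w, B w, C w)) \<le> (?t (A w, B w, C w) - 1) / ln 2"
        unfolding log_def by (intro divide_right_mono) auto
    qed
  qed
  also have "\<dots> = (measure_pmf.expectation M (\<lambda>w. ?t (A w, B w, C w)) - 1) / ln 2"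
    using integrable_measure_pmf_finite[OF fin, of "\<lambda>w. ?t (A w, B w, C w)"] by simp
  also have "\<dots> \<le> 0"
    using le1 by (simp add: divide_nonpos_pos)
  finally show ?thesis by simp
qed

section \<open>Conditional independence through a channel\<close>

text \<open>On the event \<open>k w = c\<close> the kernel is the fixed law \<open>K c\<close>,
  which leaves the integral as a constant factor.\<close>

lemma measure_bind_channel:
  "measure_pmf.prob (bind_pmf M (\<lambda>w. map_pmf (Pair w) (K (k w)))) {(w, u). w \<in> S \<and> u \<in> T \<and> k w = c}
   = measure_pmf.prob M {w \<in> S. k w = c} * measure_pmf.prob (K c) T"
proof -
  let ?N = "bind_pmf M (\<lambda>w. map_pmf (Pair w) (K (k w)))"
  have "emeasure ?N {(w, u). w \<in> S \<and> u \<in> T \<and> k w = c}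
      = (\<integral>\<^sup>+w. emeasure (K c) T * indicator {w \<in> S. k w = c} w \<partial>measure_pmf M)"
    unfolding emeasure_bind_pmf
    by (intro nn_integral_cong) (auto simp: vimage_def indicator_def)
  also have "\<dots> = emeasure (K c) T * emeasure M {w \<in> S. k w = c}"
    by (simp add: nn_integral_cmult)
  finally have "ennreal (measure ?N {(w, u). w \<in> S \<and> u \<in> T \<and> k w = c})
      = ennreal (measure M {w \<in> S. k w = c} * measure (K c) T)"
    by (simp add: measure_pmf.emeasure_eq_measure ennreal_mult mult.commute)
  then show ?thesis by simp
qed

text \<open>The channel reads only \<open>k w\<close>, so its output carries no further information
  on \<open>w\<close>. Each of the four probabilities is an instance of
  \<open>measure_bind_channel\<close>, with \<open>UNIV\<close> for an unconstrained
  component.\<close>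

lemma cond_indep_channel:
  "cond_indep (bind_pmf M (\<lambda>w. map_pmf (Pair w) (K (k w))))
     (\<lambda>(w, u). h u) (\<lambda>(w, u). g w) (\<lambda>(w, u). k w)"
  unfolding cond_indep_def
proof (intro allI)
  fix a b c
  let ?p = "measure_pmf.prob (bind_pmf M (\<lambda>w. map_pmf (Pair w) (K (k w))))"
  have *: "?p {x. (case x of (w, u) \<Rightarrow> h u) = a \<and> (case x of (w, u) \<Rightarrow> g w) = b \<and> (case x of (w, u) \<Rightarrow> k w) = c}
      = measure_pmf.prob M {w \<in> {w. g w = b}. k w = c} * measure_pmf.prob (K c) {u. h u = a}"
    "?p {x. (case x of (w, u) \<Rightarrow> k w) = c}
      = measure_pmf.prob M {w \<in> UNIV. k w = c} * measure_pmf.prob (K c) UNIV"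
    "?p {x. (case x of (w, u) \<Rightarrow> h u) = a \<and> (case x of (w, u) \<Rightarrow> k w) = c}
      = measure_pmf.prob M {w \<in> UNIV. k w = c} * measure_pmf.prob (K c) {u. h u = a}"
    "?p {x. (case x of (w, u) \<Rightarrow> g w) = b \<and> (case x of (w, u) \<Rightarrow> k w) = c}
      = measure_pmf.prob M {w \<in> {w. g w = b}. k w = c} * measure_pmf.prob (K c) UNIV"
    unfolding measure_bind_channel[symmetric] by (auto intro!: arg_cong[where f = ?p])
  show "?p {x. (case x of (w, u) \<Rightarrow> h u) = a \<and> (case x of (w, u) \<Rightarrow> g w) = b \<and> (case x of (w, u) \<Rightarrow> k w) = c} *
      ?p {x. (case x of (w, u) \<Rightarrow> k w) = c} =
      ?p {x. (case x of (w, u) \<Rightarrow> h u) = a \<and> (case x of (w, u) \<Rightarrow> k w) = c} *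
      ?p {x. (case x of (w, u) \<Rightarrow> g w) = b \<and> (case x of (w, u) \<Rightarrow> k w) = c}"
    unfolding * by simp
qed

section \<open>Bounds on the functional\<close>

definition objective :: "('x::countable \<times> 'y::countable \<times> 'z::countable \<times> nat \<times> nat \<times> nat) pmf \<Rightarrow> real" where
  "objective R =
     cond_mutual_info R (\<lambda>(x, y, z, j, u, v). x) (\<lambda>(x, y, z, j, u, v). y) (\<lambda>(x, y, z, j, u, v). j)
   + cond_mutual_info R (\<lambda>(x, y, z, j, u, v). u) (\<lambda>(x, y, z, j, u, v). j) (\<lambda>(x, y, z, j, u, v). v)
   - cond_mutual_info R (\<lambda>(x, y, z, j, u, v). u) (\<lambda>(x, y, z, j, u, v). z) (\<lambda>(x, y, z, j, u, v). v)"

lemma Psi_leI: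
  assumes "Q \<in> J_choices P" "\<And>R. R \<in> UV_choices Q \<Longrightarrow> objective R \<le> c"
  shows "Psi P \<le> ereal c"
  unfolding Psi_def objective_def[symmetric]
  using assms by (intro INF_lower2[of Q] SUP_least) auto

lemma Psi_geI:
  assumes "\<And>Q. Q \<in> J_choices P \<Longrightarrow> \<exists>R \<in> UV_choices Q. c \<le> objective R"
  shows "ereal c \<le> Psi P"
  unfolding Psi_def objective_def[symmetric]
  using assms by (intro INF_greatest) (meson SUP_upper2 ereal_less_eq(3))

section \<open>Conditional mutual information in degenerate cases\<close>

lemma cond_mutual_info_nonneg:
  fixes X :: "'w \<Rightarrow> 'a::countable" and Y :: "'w \<Rightarrow> 'b::countable" and Z :: "'w \<Rightarrow> 'c::countable"
  assumes "finite (set_pmf M)"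
  shows "0 \<le> cond_mutual_info M X Y Z"
  using H_submodular[OF assms, of Z X Y] by (simp add: cond_mutual_info_eq[OF assms])

lemma cond_mutual_info_eq_0:
  fixes X :: "'w \<Rightarrow> 'a::countable" and Y :: "'w \<Rightarrow> 'b::countable" and Z :: "'w \<Rightarrow> 'c::countable"
  assumes "finite (set_pmf M)" "cond_indep M X Y Z"
  shows "cond_mutual_info M X Y Z = 0"
  using H_cond_indep[OF assms] by (simp add: cond_mutual_info_eq[OF assms(1)])

lemma H_const_on:
  assumes "\<And>w. w \<in> set_pmf M \<Longrightarrow> f w = c"
  shows "H M f = 0"
  using H_cong[of M f "\<lambda>_. c"] assms by (auto simp: H_const)

lemma mutual_info_eq_cond_const:
  fixes X :: "'w \<Rightarrow> 'a::countable" and Y :: "'w \<Rightarrow> 'b::countable" and Z :: "'w \<Rightarrow> 'c::countable"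
  assumes "finite (set_pmf M)" "\<And>w. w \<in> set_pmf M \<Longrightarrow> Z w = c"
  shows "cond_mutual_info M X Y Z = mutual_info M X Y"
proof -
  have "H M (\<lambda>w. (X w, Z w)) = H M X" "H M (\<lambda>w. (Y w, Z w)) = H M Y"
    "H M (\<lambda>w. (X w, Y w, Z w)) = H M (\<lambda>w. (X w, Y w))"
    by (rule H_cong; use assms(2) in auto)+
  then show ?thesis
    using H_const_on[of M Z c] assms by (simp add: cond_mutual_info_eq mutual_info_eq)
qed

lemma cond_mutual_info_const_left:
  fixes X :: "'w \<Rightarrow> 'a::countable" and Y :: "'w \<Rightarrow> 'b::countable" and Z :: "'w \<Rightarrow> 'c::countable"
  assumes "finite (set_pmf M)" "\<And>w. w \<in> set_pmf M \<Longrightarrow> X w = c"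
  shows "cond_mutual_info M X Y Z = 0"
proof -
  have "H M (\<lambda>w. (X w, Z w)) = H M Z" "H M (\<lambda>w. (X w, Y w, Z w)) = H M (\<lambda>w. (Y w, Z w))"
    by (rule H_cong; use assms(2) in auto)+
  then show ?thesis using assms(1) by (simp add: cond_mutual_info_eq)
qed

lemma cond_mutual_info_const_right:
  fixes X :: "'w \<Rightarrow> 'a::countable" and Y :: "'w \<Rightarrow> 'b::countable" and Z :: "'w \<Rightarrow> 'c::countable"
  assumes "finite (set_pmf M)" "\<And>w. w \<in> set_pmf M \<Longrightarrow> Y w = c"
  shows "cond_mutual_info M X Y Z = 0"
proof -
  have "H M (\<lambda>w. (Y w, Z w)) = H M Z" "H M (\<lambda>w. (X w, Y w, Z w)) = H M (\<lambda>w. (X w, Z w))"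
    by (rule H_cong; use assms(2) in auto)+
  then show ?thesis using assms(1) by (simp add: cond_mutual_info_eq)
qed

lemma mutual_info_map:
  fixes X :: "'w \<Rightarrow> 'a::countable" and Y :: "'w \<Rightarrow> 'b::countable"
  assumes "finite (set_pmf M)"
  shows "mutual_info (map_pmf g M) X Y = mutual_info M (\<lambda>w. X (g w)) (\<lambda>w. Y (g w))"
  using assms by (simp add: mutual_info_eq H_map_pmf)

text \<open>For constant J the first term is I(X;Y), the second is 0 and the third is subtracted and
  nonnegative, whatever (U,V) is.\<close>

lemma Psi_le_mutual_info:
  fixes P :: "('x::countable \<times> 'y::countable \<times> 'z::countable) pmf"
  assumes fin: "finite (set_pmf P)"
  shows "Psi P \<le> ereal (mutual_info P (\<lambda>(x, y, z). x) (\<lambda>(x, y, z). y))"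
proof (rule Psi_leI)
  let ?Q = "map_pmf (\<lambda>(x, y, z). (x, y, z, 0 :: nat)) P"
  show "?Q \<in> J_choices P"
    using fin by (simp add: J_choices_def map_pmf_comp split_def)
  fix R assume "R \<in> UV_choices ?Q"
  then have finR: "finite (set_pmf R)" and Q: "map_pmf (\<lambda>(x, y, z, j, u, v). (x, y, z, j)) R = ?Q"
    by (auto simp: UV_choices_def)
  have P: "P = map_pmf (\<lambda>(x, y, z, j, u, v). (x, y, z)) R"
    using arg_cong[OF Q, of "map_pmf (\<lambda>(x, y, z, j). (x, y, z))"]
    by (simp add: map_pmf_comp split_def)
  have j0: "(case w of (x, y, z, j, u, v) \<Rightarrow> j) = 0" if "w \<in> set_pmf R" for w
  proof -
    have "(case w of (x, y, z, j, u, v) \<Rightarrow> (x, y, z, j)) \<in> set_pmf ?Q"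
      unfolding Q[symmetric] set_map_pmf by (rule imageI[OF that])
    then show ?thesis by (auto split: prod.splits)
  qed
  have "cond_mutual_info R (\<lambda>(x, y, z, j, u, v). u) (\<lambda>(x, y, z, j, u, v). j) (\<lambda>(x, y, z, j, u, v). v) = 0"
    by (rule cond_mutual_info_const_right[OF finR j0])
  moreover have "cond_mutual_info R (\<lambda>(x, y, z, j, u, v). x) (\<lambda>(x, y, z, j, u, v). y) (\<lambda>(x, y, z, j, u, v). j)
      = mutual_info P (\<lambda>(x, y, z). x) (\<lambda>(x, y, z). y)"
  proof -
    have "cond_mutual_info R (\<lambda>(x, y, z, j, u, v). x) (\<lambda>(x, y, z, j, u, v). y) (\<lambda>(x, y, z, j, u, v). j)
        = mutual_info R (\<lambda>(x, y, z, j, u, v). x) (\<lambda>(x, y, z, j, u, v). y)"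
      by (rule mutual_info_eq_cond_const[OF finR j0])
    then show ?thesis
      unfolding P mutual_info_map[OF finR] by (simp add: split_def)
  qed
  ultimately show "objective R \<le> mutual_info P (\<lambda>(x, y, z). x) (\<lambda>(x, y, z). y)"
    using cond_mutual_info_nonneg[OF finR, of "\<lambda>(x, y, z, j, u, v). u" "\<lambda>(x, y, z, j, u, v). z" "\<lambda>(x, y, z, j, u, v). v"]
    by (simp add: objective_def)
qed

section \<open>Entropy inequalities for the lower and the upper bound\<close>

text \<open>
  Given the two independence hypotheses, the slack is \<open>I(U;J|X) + I(U;J|Y) + I(X;Y|U,J)\<close>.
\<close>

lemma common_information_bound:
  assumes fin: "finite (set_pmf M)"
    and XY: "cond_indep M X Y U" and UJ: "cond_indep M U J (\<lambda>w. (X w, Y w))"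
  shows "H M X + H M Y - H M (\<lambda>w. (X w, Y w)) \<le>
      H M (\<lambda>w. (X w, J w)) + H M (\<lambda>w. (Y w, J w)) - H M J - H M (\<lambda>w. (X w, Y w, J w))
    + (H M U + H M J - H M (\<lambda>w. (U w, J w)))"
proof -
  note H_cond_indep[OF fin XY] H_cond_indep[OF fin UJ]
    H_submodular[OF fin, of X U J] H_submodular[OF fin, of Y U J]
    H_submodular[OF fin, of "\<lambda>w. (U w, J w)" X Y]
  moreover have "H M (\<lambda>w. (U w, X w)) = H M (\<lambda>w. (X w, U w))"
    "H M (\<lambda>w. (U w, Y w)) = H M (\<lambda>w. (Y w, U w))"
    "H M (\<lambda>w. (J w, X w)) = H M (\<lambda>w. (X w, J w))"
    "H M (\<lambda>w. (J w, Y w)) = H M (\<lambda>w. (Y w, J w))"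
    "H M (\<lambda>w. (U w, X w, Y w)) = H M (\<lambda>w. (X w, Y w, U w))"
    "H M (\<lambda>w. (J w, X w, Y w)) = H M (\<lambda>w. (X w, Y w, J w))"
    "H M (\<lambda>w. (U w, J w, X w, Y w)) = H M (\<lambda>w. (X w, Y w, U w, J w))"
    "H M (\<lambda>w. (U w, J w, X w)) = H M (\<lambda>w. (X w, U w, J w))"
    "H M (\<lambda>w. (U w, J w, Y w)) = H M (\<lambda>w. (Y w, U w, J w))"
    by (rule H_cong; auto)+
  ultimately show ?thesis by linarith
qed

text \<open>Data processing in the form H(U|Z,V) \<le> H(U|J,V). The hypotheses say that J, Z, S,
  (U,V) form a Markov chain. The first four facts yield I(U,V;J|Z) \<le> 0, and the last two then
  pass from conditioning on (J,V) through (J,Z,V) to (Z,V).\<close>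

lemma degraded_bound:
  assumes fin: "finite (set_pmf M)"
    and UV: "cond_indep M (\<lambda>w. (U w, V w)) (\<lambda>w. (J w, Z w)) S" and JS: "cond_indep M J S Z"
  shows "H M (\<lambda>w. (J w, V w)) - H M (\<lambda>w. (U w, J w, V w))
    \<le> H M (\<lambda>w. (Z w, V w)) - H M (\<lambda>w. (U w, Z w, V w))"
proof -
  note H_cond_indep[OF fin UV] H_cond_indep[OF fin JS]
    H_submodular[OF fin, of S "\<lambda>w. (U w, V w)" Z]
    H_submodular[OF fin, of "\<lambda>w. (U w, V w, Z w)" S J]
    H_submodular[OF fin, of Z V J]
    H_submodular[OF fin, of "\<lambda>w. (J w, V w)" U Z]
  moreover have "H M (\<lambda>w. ((U w, V w), S w)) = H M (\<lambda>w. (U w, V w, S w))"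
    "H M (\<lambda>w. ((J w, Z w), S w)) = H M (\<lambda>w. (J w, S w, Z w))"
    "H M (\<lambda>w. ((U w, V w), (J w, Z w), S w)) = H M (\<lambda>w. (U w, V w, J w, Z w, S w))"
    "H M (\<lambda>w. (Z w, S w)) = H M (\<lambda>w. (S w, Z w))"
    "H M (\<lambda>w. ((U w, V w), Z w, S w)) = H M (\<lambda>w. (S w, U w, V w, Z w))"
    "H M (\<lambda>w. (J w, U w, V w, Z w)) = H M (\<lambda>w. (U w, Z w, J w, V w))"
    "H M (\<lambda>w. (S w, J w, U w, V w, Z w)) = H M (\<lambda>w. (U w, V w, J w, Z w, S w))"
    "H M (\<lambda>w. (V w, Z w)) = H M (\<lambda>w. (Z w, V w))"
    "H M (\<lambda>w. (V w, J w, Z w)) = H M (\<lambda>w. (Z w, J w, V w))"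
    "H M (\<lambda>w. (U w, V w, Z w)) = H M (\<lambda>w. (U w, Z w, V w))"
    by (rule H_cong; auto)+
  ultimately show ?thesis by linarith
qed

section \<open>Realising a prescribed law of (U,X,Y) next to an arbitrary J\<close>

text \<open>Disintegration: \<open>W\<close> is recovered from its second marginal and the
  conditional laws of its first coordinate. The second marginal may therefore be carried by a larger
  sample space.\<close>

lemma pair_law_channel:
  assumes "map_pmf k M = map_pmf snd W"
  shows "bind_pmf M (\<lambda>w. map_pmf (\<lambda>u. (u, k w)) (map_pmf fst (cond_pmf W {x. snd x = k w}))) = W"
proof -
  have "bind_pmf M (\<lambda>w. map_pmf (\<lambda>u. (u, k w)) (map_pmf fst (cond_pmf W {x. snd x = k w})))
      = bind_pmf (map_pmf snd W) (\<lambda>c. map_pmf (\<lambda>u. (u, c)) (map_pmf fst (cond_pmf W {x. snd x = c})))"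
    unfolding assms[symmetric] bind_map_pmf ..
  also have "\<dots> = bind_pmf (map_pmf snd W) (\<lambda>c. cond_pmf W {x. c = snd x})"
  proof (intro bind_pmf_cong refl)
    fix c assume "c \<in> set_pmf (map_pmf snd W)"
    then have ne: "set_pmf W \<inter> {x. snd x = c} \<noteq> {}" by auto
    have "map_pmf (\<lambda>u. (u, c)) (map_pmf fst (cond_pmf W {x. snd x = c})) = cond_pmf W {x. snd x = c}"
      unfolding map_pmf_comp by (rule map_pmf_idI) (use set_cond_pmf[OF ne] in auto)
    then show "map_pmf (\<lambda>u. (u, c)) (map_pmf fst (cond_pmf W {x. snd x = c}))
        = cond_pmf W {x. c = snd x}"
      by (simp add: eq_commute[of c])
  qed
  also have "\<dots> = W"
    by (rule bind_cond_pmf_cancel) (auto simp: vimage_def eq_commute)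
  finally show ?thesis .
qed

text \<open>J and the desired law of (U,X,Y) are given separately. Drawing U from its conditional
  law given (X,Y) joins them, and since this draw looks only at (X,Y), U is independent of (J,Z)
  given (X,Y). V is the constant 0.\<close>

lemma UV_choices_extend:
  fixes P :: "('x \<times> 'y \<times> 'z) pmf" and W :: "(nat \<times> 'x \<times> 'y) pmf"
  assumes Q: "Q \<in> J_choices P" and finW: "finite (set_pmf W)"
    and W: "map_pmf snd W = map_pmf (\<lambda>(x, y, z). (x, y)) P"
  shows "\<exists>R\<in>UV_choices Q. map_pmf (\<lambda>(x, y, z, j, u, v). (u, x, y)) R = W
    \<and> (\<forall>w\<in>set_pmf R. (case w of (x, y, z, j, u, v) \<Rightarrow> v) = 0)
    \<and> cond_indep R (\<lambda>(x, y, z, j, u, v). u) (\<lambda>(x, y, z, j, u, v). j) (\<lambda>(x, y, z, j, u, v). (x, y))"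
proof -
  define k :: "'x \<times> 'y \<times> 'z \<times> nat \<Rightarrow> 'x \<times> 'y" where "k = (\<lambda>(x, y, z, j). (x, y))"
  define K where "K c = map_pmf fst (cond_pmf W {x. snd x = c})" for c
  define N where "N = bind_pmf Q (\<lambda>w. map_pmf (Pair w) (K (k w)))"
  define R where "R = map_pmf (\<lambda>((x, y, z, j), u). (x, y, z, j, u, 0 :: nat)) N"
  from Q have finQ: "finite (set_pmf Q)" and QP: "map_pmf (\<lambda>(x, y, z, j). (x, y, z)) Q = P"
    by (auto simp: J_choices_def)
  have kQ: "map_pmf k Q = map_pmf snd W"
    unfolding W QP[symmetric] by (simp add: map_pmf_comp k_def split_def)
  \<comment> \<open>\<open>cond_pmf\<close> is meaningful only when the conditioning event meets the
    support of \<open>W\<close>, hence the restriction to the support of \<open>Q\<close>.\<close>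
  have finK: "finite (set_pmf (K (k w)))" if "w \<in> set_pmf Q" for w
  proof -
    have "k w \<in> set_pmf (map_pmf snd W)"
      unfolding kQ[symmetric] using that by simp
    then have "set_pmf W \<inter> {x. snd x = k w} \<noteq> {}" by auto
    then show ?thesis
      unfolding K_def set_map_pmf set_cond_pmf[OF \<open>set_pmf W \<inter> {x. snd x = k w} \<noteq> {}\<close>]
      using finW by simp
  qed
  have finR: "finite (set_pmf R)"
    unfolding R_def N_def using finQ finK by simp
  have RQ: "map_pmf (\<lambda>(x, y, z, j, u, v). (x, y, z, j)) R = Q"
  proof -
    have "map_pmf (\<lambda>(x, y, z, j, u, v). (x, y, z, j)) R = map_pmf fst N"
      unfolding R_def map_pmf_comp by (intro map_pmf_cong refl) auto
    also have "\<dots> = Q"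
      unfolding N_def by (simp add: map_bind_pmf map_pmf_comp bind_return_pmf')
    finally show ?thesis .
  qed
  have RW: "map_pmf (\<lambda>(x, y, z, j, u, v). (u, x, y)) R = W"
  proof -
    have "map_pmf (\<lambda>(x, y, z, j, u, v). (u, x, y)) R = map_pmf (\<lambda>(w, u). (u, k w)) N"
      unfolding R_def map_pmf_comp by (intro map_pmf_cong refl) (auto simp: k_def)
    also have "\<dots> = bind_pmf Q (\<lambda>w. map_pmf (\<lambda>u. (u, k w)) (map_pmf fst (cond_pmf W {x. snd x = k w})))"
      unfolding N_def K_def by (simp add: map_bind_pmf map_pmf_comp)
    also have "\<dots> = W" by (rule pair_law_channel[OF kQ])
    finally show ?thesis .
  qed
  \<comment> \<open>Stated for general \<open>h\<close> and \<open>g\<close> because it is used both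
    for (U,V) against (J,Z) and for U against J.\<close>
  have ci: "cond_indep R (\<lambda>(x, y, z, j, u, v). h u v) (\<lambda>(x, y, z, j, u, v). g j z) (\<lambda>(x, y, z, j, u, v). (x, y))"
    for h :: "nat \<Rightarrow> nat \<Rightarrow> 'h" and g :: "nat \<Rightarrow> 'z \<Rightarrow> 'g"
  proof -
    have "cond_indep N (\<lambda>(w, u). h u 0) (\<lambda>(w, u). (\<lambda>(x, y, z, j). g j z) w) (\<lambda>(w, u). k w)"
      unfolding N_def by (rule cond_indep_channel)
    then show ?thesis
      unfolding R_def cond_indep_map by (simp add: k_def split_def)
  qed
  show ?thesis
  proof (intro bexI[of _ R] conjI ballI)
    show "R \<in> UV_choices Q"
      using finR RQ ci[of "\<lambda>u v. (u, v)" "\<lambda>j z. (j, z)"] by (simp add: UV_choices_def)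
    show "map_pmf (\<lambda>(x, y, z, j, u, v). (u, x, y)) R = W" by (rule RW)
    show "(case w of (x, y, z, j, u, v) \<Rightarrow> v) = 0" if "w \<in> set_pmf R" for w
      using that by (auto simp: R_def)
    show "cond_indep R (\<lambda>(x, y, z, j, u, v). u) (\<lambda>(x, y, z, j, u, v). j) (\<lambda>(x, y, z, j, u, v). (x, y))"
      by (rule ci)
  qed
qed

text \<open>A constant U makes both terms containing U vanish and leaves I(X;Y|J).\<close>

lemma Psi_nonneg:
  fixes P :: "('x::countable \<times> 'y::countable \<times> 'z::countable) pmf"
  assumes fin: "finite (set_pmf P)"
  shows "0 \<le> Psi P"
proof -
  have "ereal 0 \<le> Psi P"
  proof (rule Psi_geI)
    fix Q assume Q: "Q \<in> J_choices P"
    let ?W = "map_pmf (\<lambda>(x, y, z). (0 :: nat, x, y)) P"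
    have W: "finite (set_pmf ?W)" "map_pmf snd ?W = map_pmf (\<lambda>(x, y, z). (x, y)) P"
      using fin by (simp_all add: map_pmf_comp split_def)
    from UV_choices_extend[OF Q W] obtain R where R: "R \<in> UV_choices Q"
      and RW: "map_pmf (\<lambda>(x, y, z, j, u, v). (u, x, y)) R = ?W"
      by blast
    have finR: "finite (set_pmf R)" using R by (simp add: UV_choices_def)
    have u0: "(case w of (x, y, z, j, u, v) \<Rightarrow> u) = 0" if "w \<in> set_pmf R" for w
    proof -
      have "(case w of (x, y, z, j, u, v) \<Rightarrow> (u, x, y)) \<in> set_pmf ?W"
        unfolding RW[symmetric] set_map_pmf by (rule imageI[OF that])
      then show ?thesis by (auto split: prod.splits)
    qed
    have zero: "cond_mutual_info R (\<lambda>(x, y, z, j, u, v). u) T (\<lambda>(x, y, z, j, u, v). v) = 0"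
      for T :: "'x \<times> 'y \<times> 'z \<times> nat \<times> nat \<times> nat \<Rightarrow> 't::countable"
      by (rule cond_mutual_info_const_left[OF finR u0])
    have "0 \<le> objective R"
      using cond_mutual_info_nonneg[OF finR, of "\<lambda>(x, y, z, j, u, v). x" "\<lambda>(x, y, z, j, u, v). y"
          "\<lambda>(x, y, z, j, u, v). j"]
      unfolding objective_def zero by linarith
    then show "\<exists>R\<in>UV_choices Q. 0 \<le> objective R" using R by blast
  qed
  then show ?thesis by (simp add: zero_ereal_def)
qed

section \<open>Lower bound from a U independent of Z\<close>

lemma cond_indep_pair_pmf:
  assumes "map_pmf (\<lambda>w. (A w, B w)) M = pair_pmf p q"
  shows "cond_indep M A B (\<lambda>_. c)"
proof -
  have "measure_pmf.prob M {w. A w = a \<and> B w = b} = measure_pmf.prob M {w. A w = a} * measure_pmf.prob M {w. B w = b}"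
    for a b
  proof -
    have "map_pmf A M = p"
      using arg_cong[OF assms, of "map_pmf fst"] by (simp add: map_pmf_comp map_fst_pair_pmf)
    moreover have "map_pmf B M = q"
      using arg_cong[OF assms, of "map_pmf snd"] by (simp add: map_pmf_comp map_snd_pair_pmf)
    ultimately have "pmf (map_pmf (\<lambda>w. (A w, B w)) M) (a, b) = pmf (map_pmf A M) a * pmf (map_pmf B M) b"
      by (simp only: assms pmf_pair)
    then show ?thesis by (simp add: pmf_map vimage_def)
  qed
  then show ?thesis by (auto simp: cond_indep_def)
qed

text \<open>\<open>W\<close> is the law of (U,X,Y). Placed next to any J with V constant, it makes
  the subtracted term I(U;Z) = 0, and \<open>common_information_bound\<close> handles the other
  two.\<close>

lemma mutual_info_le_Psi:
  fixes P :: "('x::countable \<times> 'y::countable) pmf" and W :: "(nat \<times> 'x \<times> 'y) pmf"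
    and f :: "'x \<Rightarrow> 'y \<Rightarrow> 'z::countable"
  assumes finW: "finite (set_pmf W)" and WP: "map_pmf snd W = P"
    and XUY: "cond_indep W (\<lambda>(u, x, y). x) (\<lambda>(u, x, y). y) (\<lambda>(u, x, y). u)"
    and UZ: "map_pmf (\<lambda>(u, x, y). (u, f x y)) W = pair_pmf p q"
  shows "ereal (mutual_info P fst snd) \<le> Psi (adjoin f P)"
proof (rule Psi_geI)
  fix Q assume Q: "Q \<in> J_choices (adjoin f P)"
  have W: "map_pmf snd W = map_pmf (\<lambda>(x, y, z). (x, y)) (adjoin f P)"
    by (simp add: WP adjoin_def map_pmf_comp split_def)
  from UV_choices_extend[OF Q finW W] obtain R where R: "R \<in> UV_choices Q"
    and RW: "map_pmf (\<lambda>(x, y, z, j, u, v). (u, x, y)) R = W"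
    and v0: "\<forall>w\<in>set_pmf R. (case w of (x, y, z, j, u, v) \<Rightarrow> v) = 0"
    and UJ: "cond_indep R (\<lambda>(x, y, z, j, u, v). u) (\<lambda>(x, y, z, j, u, v). j) (\<lambda>(x, y, z, j, u, v). (x, y))"
    by blast
  have finR: "finite (set_pmf R)" using R by (simp add: UV_choices_def)
  \<comment> \<open>The relation Z = f(X,Y) is known only through the marginal of \<open>R\<close>,
    so it holds on the support.\<close>
  have zf: "(case w of (x, y, z, j, u, v) \<Rightarrow> z) = (case w of (x, y, z, j, u, v) \<Rightarrow> f x y)"
    if "w \<in> set_pmf R" for w
  proof -
    have RP: "map_pmf (\<lambda>(x, y, z, j, u, v). (x, y, z)) R = adjoin f P"
    proof -
      have "map_pmf (\<lambda>(x, y, z, j, u, v). (x, y, z, j)) R = Q"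
        using R by (simp add: UV_choices_def)
      from arg_cong[OF this, of "map_pmf (\<lambda>(x, y, z, j). (x, y, z))"] show ?thesis
        using Q by (simp add: J_choices_def map_pmf_comp split_def)
    qed
    have "(case w of (x, y, z, j, u, v) \<Rightarrow> (x, y, z)) \<in> set_pmf (adjoin f P)"
      unfolding RP[symmetric] set_map_pmf by (rule imageI[OF that])
    then show ?thesis by (auto simp: adjoin_def split: prod.splits)
  qed
  have "map_pmf (\<lambda>w. (case w of (x, y, z, j, u, v) \<Rightarrow> u, case w of (x, y, z, j, u, v) \<Rightarrow> z)) R
      = map_pmf (\<lambda>(u, x, y). (u, f x y)) W"
    unfolding RW[symmetric] map_pmf_comp
    by (intro map_pmf_cong refl) (use zf in \<open>force split: prod.splits\<close>)
  then have UZ_indep: "cond_indep R (\<lambda>(x, y, z, j, u, v). u) (\<lambda>(x, y, z, j, u, v). z) (\<lambda>_. 0 :: nat)"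
    unfolding UZ by (rule cond_indep_pair_pmf)
  have v: "cond_mutual_info R (\<lambda>(x, y, z, j, u, v). u) T (\<lambda>(x, y, z, j, u, v). v)
      = mutual_info R (\<lambda>(x, y, z, j, u, v). u) T"
    for T :: "'x \<times> 'y \<times> 'z \<times> nat \<times> nat \<times> nat \<Rightarrow> 't::countable"
    by (rule mutual_info_eq_cond_const[OF finR v0[rule_format]])
  \<comment> \<open>Independence is phrased as conditional independence given a constant, which must
    be translated back to I(U;Z).\<close>
  have "cond_mutual_info R (\<lambda>(x, y, z, j, u, v). u) (\<lambda>(x, y, z, j, u, v). z) (\<lambda>_. 0 :: nat)
      = mutual_info R (\<lambda>(x, y, z, j, u, v). u) (\<lambda>(x, y, z, j, u, v). z)"
    by (rule mutual_info_eq_cond_const[OF finR]) auto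
  then have UZ0: "mutual_info R (\<lambda>(x, y, z, j, u, v). u) (\<lambda>(x, y, z, j, u, v). z) = 0"
    using cond_mutual_info_eq_0[OF finR UZ_indep] by linarith
  have XUY_R: "cond_indep R (\<lambda>(x, y, z, j, u, v). x) (\<lambda>(x, y, z, j, u, v). y) (\<lambda>(x, y, z, j, u, v). u)"
    using XUY unfolding RW[symmetric] cond_indep_map by (simp add: split_def)
  have UJ_R: "cond_indep R (\<lambda>(x, y, z, j, u, v). u) (\<lambda>(x, y, z, j, u, v). j)
      (\<lambda>w. (case w of (x, y, z, j, u, v) \<Rightarrow> x, case w of (x, y, z, j, u, v) \<Rightarrow> y))"
    using UJ by (simp add: split_def)
  have "mutual_info R (\<lambda>(x, y, z, j, u, v). x) (\<lambda>(x, y, z, j, u, v). y) \<le> objective R"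
    using common_information_bound[OF finR XUY_R UJ_R]
    unfolding objective_def v UZ0
    unfolding cond_mutual_info_eq[OF finR] mutual_info_eq[OF finR] by linarith
  moreover have "mutual_info P fst snd = mutual_info R (\<lambda>(x, y, z, j, u, v). x) (\<lambda>(x, y, z, j, u, v). y)"
    unfolding WP[symmetric] RW[symmetric] map_pmf_comp mutual_info_map[OF finR] by (simp add: split_def)
  ultimately show "\<exists>R\<in>UV_choices Q. mutual_info P fst snd \<le> objective R"
    using R by auto
qed

section \<open>Upper bound from a J degraded from Z\<close>

text \<open>J is drawn from Z alone, so data processing gives I(U;J|V) \<le> I(U;Z|V) for every
  admissible (U,V). The hypothesis \<open>ci\<close> makes I(X;Y|J) vanish.\<close>

lemma Psi_le_0:
  fixes P :: "('x::countable \<times> 'y::countable \<times> 'z::countable) pmf" and K :: "'z \<Rightarrow> nat pmf"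
  assumes fin: "finite (set_pmf P)" and finK: "\<And>z. finite (set_pmf (K z))"
    and ci: "cond_indep (bind_pmf P (\<lambda>(x, y, z). map_pmf (\<lambda>j. (x, y, z, j)) (K z)))
      (\<lambda>(x, y, z, j). x) (\<lambda>(x, y, z, j). y) (\<lambda>(x, y, z, j). j)"
  shows "Psi P \<le> 0"
proof -
  \<comment> \<open>\<open>N\<close> is \<open>Q\<close> bracketed as (input, output), the shape
    required by \<open>cond_indep_channel\<close>.\<close>
  define N where "N = bind_pmf P (\<lambda>w. map_pmf (Pair w) (K (snd (snd w))))"
  define Q where "Q = bind_pmf P (\<lambda>(x, y, z). map_pmf (\<lambda>j. (x, y, z, j)) (K z))"
  have QN: "Q = map_pmf (\<lambda>((x, y, z), j). (x, y, z, j)) N"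
    unfolding Q_def N_def map_bind_pmf map_pmf_comp by (simp add: split_def)
  have "Psi P \<le> ereal 0"
  proof (rule Psi_leI)
    have "map_pmf (\<lambda>(x, y, z, j). (x, y, z)) Q = map_pmf fst N"
      unfolding QN map_pmf_comp by (intro map_pmf_cong refl) auto
    also have "\<dots> = P"
      unfolding N_def by (simp add: map_bind_pmf map_pmf_comp bind_return_pmf')
    finally show "Q \<in> J_choices P"
      using fin finK by (auto simp: J_choices_def Q_def)
    fix R assume R: "R \<in> UV_choices Q"
    then have finR: "finite (set_pmf R)" and RQ: "map_pmf (\<lambda>(x, y, z, j, u, v). (x, y, z, j)) R = Q"
      and UV: "cond_indep R (\<lambda>(x, y, z, j, u, v). (u, v)) (\<lambda>(x, y, z, j, u, v). (j, z))
          (\<lambda>(x, y, z, j, u, v). (x, y))"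
      by (auto simp: UV_choices_def)
    have "cond_indep Q (\<lambda>(x, y, z, j). j) (\<lambda>(x, y, z, j). (x, y)) (\<lambda>(x, y, z, j). z)"
    proof -
      have "cond_indep N (\<lambda>(w, j). j) (\<lambda>(w, j). (\<lambda>(x, y, z). (x, y)) w) (\<lambda>(w, j). snd (snd w))"
        unfolding N_def by (rule cond_indep_channel)
      then show ?thesis
        unfolding QN cond_indep_map by (simp add: split_def)
    qed
    then have JS: "cond_indep R (\<lambda>(x, y, z, j, u, v). j) (\<lambda>(x, y, z, j, u, v). (x, y)) (\<lambda>(x, y, z, j, u, v). z)"
      unfolding RQ[symmetric] cond_indep_map by (simp add: split_def)
    have "cond_indep R (\<lambda>(x, y, z, j, u, v). x) (\<lambda>(x, y, z, j, u, v). y) (\<lambda>(x, y, z, j, u, v). j)"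
      using ci unfolding Q_def[symmetric] RQ[symmetric] cond_indep_map by (simp add: split_def)
    then have "cond_mutual_info R (\<lambda>(x, y, z, j, u, v). x) (\<lambda>(x, y, z, j, u, v). y) (\<lambda>(x, y, z, j, u, v). j) = 0"
      by (rule cond_mutual_info_eq_0[OF finR])
    moreover have "cond_mutual_info R (\<lambda>(x, y, z, j, u, v). u) (\<lambda>(x, y, z, j, u, v). j) (\<lambda>(x, y, z, j, u, v). v)
        \<le> cond_mutual_info R (\<lambda>(x, y, z, j, u, v). u) (\<lambda>(x, y, z, j, u, v). z) (\<lambda>(x, y, z, j, u, v). v)"
    proof -
      have "cond_indep R (\<lambda>w. (case w of (x, y, z, j, u, v) \<Rightarrow> u, case w of (x, y, z, j, u, v) \<Rightarrow> v))
          (\<lambda>w. (case w of (x, y, z, j, u, v) \<Rightarrow> j, case w of (x, y, z, j, u, v) \<Rightarrow> z))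
          (\<lambda>(x, y, z, j, u, v). (x, y))"
        using UV by (simp add: split_def)
      from degraded_bound[OF finR this JS] show ?thesis
        unfolding cond_mutual_info_eq[OF finR] by linarith
    qed
    ultimately show "objective R \<le> 0" by (simp add: objective_def)
  qed
  then show ?thesis by (simp add: zero_ereal_def)
qed

section \<open>The binary sources\<close>

definition ber :: "real \<Rightarrow> nat pmf" where
  "ber t = map_pmf of_bool (bernoulli_pmf t)"

lemma pmf_ber:
  assumes "0 \<le> t" "t \<le> 1"
  shows "pmf (ber t) n = (if n = 1 then t else if n = 0 then 1 - t else 0)"
proof -
  have "(of_bool :: bool \<Rightarrow> nat) -` {n} = (if n = 1 then {True} else if n = 0 then {False} else {})"
  proof (rule set_eqI)
    show "b \<in> (of_bool :: bool \<Rightarrow> nat) -` {n}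
        \<longleftrightarrow> b \<in> (if n = 1 then {True} else if n = 0 then {False} else {})" for b
      by (cases b) auto
  qed
  then show ?thesis
    using assms unfolding ber_def pmf_map by (auto simp: measure_pmf_single)
qed

lemma finite_set_ber: "finite (set_pmf (ber t))"
  unfolding ber_def set_map_pmf by (rule finite_imageI) simp

lemma expectation_ber:
  fixes g :: "nat \<Rightarrow> real"
  shows "0 \<le> t \<Longrightarrow> t \<le> 1 \<Longrightarrow> measure_pmf.expectation (ber t) g = t * g 1 + (1 - t) * g 0"
  by (simp add: ber_def)

lemma cond_indep_commute:
  assumes "cond_indep M A B C"
  shows "cond_indep M B A C"
  unfolding cond_indep_def
proof (intro allI)
  fix b a c
  have "{w. B w = b \<and> A w = a \<and> C w = c} = {w. A w = a \<and> B w = b \<and> C w = c}" by auto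
  then show "measure_pmf.prob M {w. B w = b \<and> A w = a \<and> C w = c} * measure_pmf.prob M {w. C w = c}
      = measure_pmf.prob M {w. B w = b \<and> C w = c} * measure_pmf.prob M {w. A w = a \<and> C w = c}"
    using assms[unfolded cond_indep_def, rule_format, of a b c] by (simp only: mult.commute)
qed

text \<open>Draw u, then x, then y by a channel that reads only u: the claim becomes an instance of
  \<open>cond_indep_channel\<close>.\<close>

lemma cond_indep_mixture:
  "cond_indep (bind_pmf M (\<lambda>u. map_pmf (Pair u) (pair_pmf (A u) (B u))))
     (\<lambda>(u, x, y). x) (\<lambda>(u, x, y). y) (\<lambda>(u, x, y). u)"
proof -
  let ?M = "bind_pmf M (\<lambda>u. map_pmf (Pair u) (A u))"
  have *: "bind_pmf M (\<lambda>u. map_pmf (Pair u) (pair_pmf (A u) (B u)))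
      = map_pmf (\<lambda>((u, x), y). (u, x, y)) (bind_pmf ?M (\<lambda>w. map_pmf (Pair w) (B (fst w))))"
    unfolding pair_pmf_def map_pmf_def bind_assoc_pmf bind_return_pmf fst_conv prod.case ..
  have "cond_indep (bind_pmf ?M (\<lambda>w. map_pmf (Pair w) (B (fst w))))
      (\<lambda>(w, y). y) (\<lambda>(w, y). snd w) (\<lambda>(w, y). fst w)"
    using cond_indep_channel[where M = ?M and K = B and k = fst and g = snd and h = "\<lambda>y. y"] .
  from cond_indep_commute[OF this] show ?thesis
    unfolding * cond_indep_map by (simp add: split_def)
qed

text \<open>
  \<open>s\<close> and \<open>t\<close> are the roots of \<open>r\<^sup>2 - (1 - a + d) r + d\<close>, whose discriminant is
  \<open>(b + c)\<^sup>2 - 4ad\<close>. The hypothesis \<open>ad \<le> bc\<close> says that \<open>b\<close> lies between \<open>(1 - s) t\<close> and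
  \<open>(1 - t) s\<close>, two numbers with sum \<open>b + c\<close> and product \<open>ad\<close>.
\<close>

lemma exists_swap_parameters:
  fixes a b c d :: real
  assumes "0 \<le> a" "0 \<le> b" "0 \<le> c" "0 \<le> d" "a + b + c + d = 1" "a * d \<le> b * c"
  obtains s t \<theta> where "0 \<le> s" "s \<le> 1" "0 \<le> t" "t \<le> 1" "0 \<le> \<theta>" "\<theta> \<le> 1"
    "s * t = d" "(1 - s) * (1 - t) = a" "\<theta> * ((1 - s) * t) + (1 - \<theta>) * ((1 - t) * s) = b"
proof -
  define r where "r = sqrt ((b + c)\<^sup>2 - 4 * (a * d))"
  \<comment> \<open>The difference of the two sides is 4 (b c - a d), so the discriminant is
    nonnegative and its root \<open>r\<close> dominates the distance of b and c.\<close>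
  have sq: "(b - c)\<^sup>2 \<le> (b + c)\<^sup>2 - 4 * (a * d)"
    using assms by (simp add: power2_eq_square algebra_simps)
  then have nn: "0 \<le> (b + c)\<^sup>2 - 4 * (a * d)"
    by (rule order_trans[rotated]) simp
  have r2: "r * r = (b + c)\<^sup>2 - 4 * (a * d)"
    using nn by (simp add: r_def)
  have r0: "0 \<le> r" using nn by (simp add: r_def)
  have "\<bar>b - c\<bar> \<le> r"
    unfolding r_def using sq by (metis real_sqrt_abs real_sqrt_le_mono)
  then have rlow: "b - c \<le> r" "c - b \<le> r" by auto
  have rup: "r \<le> b + c"
    unfolding r_def using assms by (intro real_le_lsqrt) auto
  define s t where "s = (b + c + 2 * d + r) / 2" and "t = (b + c + 2 * d - r) / 2"
  \<comment> \<open>The weight that writes b as a convex combination of (b + c - r) / 2 and (b + c +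
    r) / 2. For \<open>r = 0\<close> both endpoints equal b, and the weight 0 will do.\<close>
  define \<theta> where "\<theta> = (if r = 0 then 0 else ((b + c + r) / 2 - b) / r)"
  have a: "a = 1 - b - c - d" using assms by simp
  have st: "s * t = d"
  proof -
    have "s * t = ((b + c + 2 * d) * (b + c + 2 * d) - r * r) / 4"
      by (simp add: s_def t_def field_simps)
    then show ?thesis unfolding r2 a by (simp add: power2_eq_square field_simps)
  qed
  have sum: "s + t = b + c + 2 * d" by (simp add: s_def t_def field_simps)
  show thesis
  proof (rule that[of s t \<theta>])
    show "0 \<le> s" "s \<le> 1" "0 \<le> t" "t \<le> 1"
      using assms r0 rup by (auto simp: s_def t_def)
    show "0 \<le> \<theta>" "\<theta> \<le> 1"
      using r0 rlow by (auto simp: \<theta>_def field_simps)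
    show "s * t = d" by (rule st)
    show "(1 - s) * (1 - t) = a"
      using st sum a by (simp add: algebra_simps)
    have "(1 - s) * t = (b + c - r) / 2" "(1 - t) * s = (b + c + r) / 2"
      using st by (simp_all add: algebra_simps) (simp_all add: s_def t_def field_simps)
    then have "\<theta> * ((1 - s) * t) + (1 - \<theta>) * ((1 - t) * s)
        = \<theta> * ((b + c - r) / 2) + (1 - \<theta>) * ((b + c + r) / 2)"
      by (simp only:)
    also have "\<dots> = (b + c + r) / 2 - \<theta> * r"
      by (simp add: field_simps)
    also have "\<dots> = b"
      using rlow by (auto simp: \<theta>_def)
    finally show "\<theta> * ((1 - s) * t) + (1 - \<theta>) * ((1 - t) * s) = b" .
  qed
qed

section \<open>The common information variable for binary sources\<close>

lemma pmf_outside: "set_pmf P \<subseteq> S \<Longrightarrow> x \<notin> S \<Longrightarrow> pmf P x = 0"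
  by (auto simp: pmf_eq_0_set_pmf)

lemma sum_binary_pmf:
  fixes P :: "(nat \<times> nat) pmf"
  assumes "set_pmf P \<subseteq> {0, 1} \<times> {0, 1}"
  shows "pmf P (0, 0) + pmf P (0, 1) + pmf P (1, 0) + pmf P (1, 1) = 1"
  using sum_pmf_eq_1[OF _ assms] by (simp add: sum.cartesian_product[symmetric])

text \<open>Given U = 1, X and Y are independent Bernoulli variables with parameters s and t; given
  U = 0 the parameters are exchanged. The weight \<theta> of U = 1 is tuned to reproduce the
  off-diagonal entries of \<open>P\<close>.\<close>

lemma exists_common_information:
  fixes P :: "(nat \<times> nat) pmf"
  assumes bin: "set_pmf P \<subseteq> {0, 1} \<times> {0, 1}"
    and le: "pmf P (0, 0) * pmf P (1, 1) \<le> pmf P (0, 1) * pmf P (1, 0)"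
  obtains W :: "(nat \<times> nat \<times> nat) pmf" and p q where "finite (set_pmf W)" "map_pmf snd W = P"
    "cond_indep W (\<lambda>(u, x, y). x) (\<lambda>(u, x, y). y) (\<lambda>(u, x, y). u)"
    "map_pmf (\<lambda>(u, x, y). (u, x + y)) W = pair_pmf p q"
proof -
  note sum1 = sum_binary_pmf[OF bin]
  obtain s t \<theta> where st: "0 \<le> s" "s \<le> 1" "0 \<le> t" "t \<le> 1" and \<theta>: "0 \<le> \<theta>" "\<theta> \<le> 1"
    and eqs: "s * t = pmf P (1, 1)" "(1 - s) * (1 - t) = pmf P (0, 0)"
      "\<theta> * ((1 - s) * t) + (1 - \<theta>) * ((1 - t) * s) = pmf P (0, 1)"
    using exists_swap_parameters[of "pmf P (0, 0)" "pmf P (0, 1)" "pmf P (1, 0)" "pmf P (1, 1)"]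
      sum1 le by auto
  define A B where "A u = (if u = 1 then ber s else ber t)" and "B u = (if u = 1 then ber t else ber s)"
    for u :: nat
  define W where "W = bind_pmf (ber \<theta>) (\<lambda>u. map_pmf (Pair u) (pair_pmf (A u) (B u)))"
  \<comment> \<open>The fourth entry is forced, since both tables have total mass 1.\<close>
  have eq10: "\<theta> * (s * (1 - t)) + (1 - \<theta>) * (t * (1 - s)) = pmf P (1, 0)"
    using sum1 unfolding eqs[symmetric] by (simp add: algebra_simps)
  show thesis
  proof (rule that[of W])
    show "finite (set_pmf W)"
      by (simp add: W_def A_def B_def finite_set_ber)
    show "map_pmf snd W = P"
    proof (rule pmf_eqI)
      fix i
      obtain x y :: nat where i: "i = (x, y)" by (cases i)
      have "map_pmf snd W = bind_pmf (ber \<theta>) (\<lambda>u. pair_pmf (A u) (B u))"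
        by (simp add: W_def map_bind_pmf map_pmf_comp)
      then have "pmf (map_pmf snd W) (x, y) = \<theta> * (pmf (ber s) x * pmf (ber t) y)
          + (1 - \<theta>) * (pmf (ber t) x * pmf (ber s) y)"
        using \<theta> by (simp add: pmf_bind expectation_ber pmf_pair A_def B_def)
      also have "\<dots> = pmf P (x, y)"
      proof (cases "(x, y) \<in> {0, 1} \<times> {0, 1}")
        case True
        then consider "x = 0" "y = 0" | "x = 0" "y = 1" | "x = 1" "y = 0" | "x = 1" "y = 1" by auto
        then show ?thesis
        proof cases
          case 1
          then show ?thesis using st eqs(2) by (simp add: pmf_ber) (simp add: algebra_simps)
        next
          case 2
          then show ?thesis using st eqs(3) by (simp add: pmf_ber)
        next
          case 3
          then show ?thesis using st eq10 by (simp add: pmf_ber)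
        next
          case 4
          then show ?thesis using st eqs(1) by (simp add: pmf_ber) (simp add: algebra_simps)
        qed
      next
        case False
        then have "pmf P (x, y) = 0" by (rule pmf_outside[OF bin])
        moreover have "x \<noteq> 0 \<and> x \<noteq> 1 \<or> y \<noteq> 0 \<and> y \<noteq> 1" using False by auto
        ultimately show ?thesis using st by (elim disjE) (simp_all add: pmf_ber)
      qed
      finally show "pmf (map_pmf snd W) i = pmf P i" by (simp add: i)
    qed
    show "cond_indep W (\<lambda>(u, x, y). x) (\<lambda>(u, x, y). y) (\<lambda>(u, x, y). u)"
      unfolding W_def by (rule cond_indep_mixture)
    \<comment> \<open>Addition is commutative, so the conditional law of X + Y given U = u is the
      same for every u.\<close>
    have swap: "map_pmf (\<lambda>(x, y). x + y) (pair_pmf (A u) (B u))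
        = map_pmf (\<lambda>(x, y). x + y) (pair_pmf (ber s) (ber t))" for u
    proof -
      have "map_pmf (\<lambda>(x, y). x + y) (pair_pmf (ber t) (ber s))
          = map_pmf (\<lambda>(x, y). x + y) (pair_pmf (ber s) (ber t))"
        by (subst pair_commute_pmf) (simp add: map_pmf_comp split_def add.commute)
      then show ?thesis by (simp add: A_def B_def)
    qed
    have "map_pmf (\<lambda>(u, x, y). (u, x + y)) W
        = bind_pmf (ber \<theta>) (\<lambda>u. map_pmf (Pair u) (map_pmf (\<lambda>(x, y). x + y) (pair_pmf (A u) (B u))))"
      by (simp add: W_def map_bind_pmf map_pmf_comp split_def)
    also have "\<dots> = pair_pmf (ber \<theta>) (map_pmf (\<lambda>(x, y). x + y) (pair_pmf (ber s) (ber t)))"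
      unfolding swap by (simp add: pair_pmf_def map_pmf_def)
    finally show "map_pmf (\<lambda>(u, x, y). (u, x + y)) W
        = pair_pmf (ber \<theta>) (map_pmf (\<lambda>(x, y). x + y) (pair_pmf (ber s) (ber t)))" .
  qed
qed

lemma finite_set_binary:
  fixes P :: "(nat \<times> nat) pmf"
  shows "set_pmf P \<subseteq> {0, 1} \<times> {0, 1} \<Longrightarrow> finite (set_pmf P)"
  by (erule finite_subset) simp

lemma Psi_adjoin_le:
  fixes P :: "('x::countable \<times> 'y::countable) pmf" and f :: "'x \<Rightarrow> 'y \<Rightarrow> 'z::countable"
  assumes "finite (set_pmf P)"
  shows "Psi (adjoin f P) \<le> ereal (mutual_info P fst snd)"
proof -
  have "mutual_info (adjoin f P) (\<lambda>(x, y, z). x) (\<lambda>(x, y, z). y) = mutual_info P fst snd"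
    unfolding adjoin_def using assms by (simp add: mutual_info_map split_def)
  moreover have fin: "finite (set_pmf (adjoin f P))"
    using assms by (simp add: adjoin_def)
  note Psi_le_mutual_info[OF fin]
  ultimately show ?thesis by (simp only:)
qed

text \<open>A U independent of X + Y is independent of every function of X + Y.\<close>

lemma Psi_adjoin_eq:
  fixes P :: "(nat \<times> nat) pmf" and f :: "nat \<Rightarrow> nat \<Rightarrow> nat"
  assumes bin: "set_pmf P \<subseteq> {0, 1} \<times> {0, 1}"
    and le: "pmf P (0, 0) * pmf P (1, 1) \<le> pmf P (0, 1) * pmf P (1, 0)"
    and fg: "\<And>x y. x \<in> {0, 1} \<Longrightarrow> y \<in> {0, 1} \<Longrightarrow> f x y = g (x + y)"
  shows "Psi (adjoin f P) = ereal (mutual_info P fst snd)"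
proof (rule antisym)
  obtain W :: "(nat \<times> nat \<times> nat) pmf" and p q where W: "finite (set_pmf W)" "map_pmf snd W = P"
    "cond_indep W (\<lambda>(u, x, y). x) (\<lambda>(u, x, y). y) (\<lambda>(u, x, y). u)"
    and UZ: "map_pmf (\<lambda>(u, x, y). (u, x + y)) W = pair_pmf p q"
    using exists_common_information[OF bin le] by metis
  have bw: "snd w \<in> {0, 1} \<times> {0, 1}" if "w \<in> set_pmf W" for w
    using that bin unfolding W(2)[symmetric] by auto
  have "map_pmf (\<lambda>(u, x, y). (u, f x y)) W
      = map_pmf (\<lambda>(u, z). (u, g z)) (map_pmf (\<lambda>(u, x, y). (u, x + y)) W)"
    unfolding map_pmf_comp
  proof (intro map_pmf_cong refl)
    fix w assume "w \<in> set_pmf W"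
    from bw[OF this] show "(case w of (u, x, y) \<Rightarrow> (u, f x y))
        = (case case w of (u, x, y) \<Rightarrow> (u, x + y) of (u, z) \<Rightarrow> (u, g z))"
      using fg by (cases w) auto
  qed
  also have "\<dots> = pair_pmf p (map_pmf g q)"
    unfolding UZ using map_pair[of "\<lambda>u. u" g p q] by simp
  finally show "ereal (mutual_info P fst snd) \<le> Psi (adjoin f P)"
    by (rule mutual_info_le_Psi[OF W])
  show "Psi (adjoin f P) \<le> ereal (mutual_info P fst snd)"
    by (rule Psi_adjoin_le[OF finite_set_binary[OF bin]])
qed

section \<open>XOR by complementing Y\<close>

text \<open>Leaving the remaining values fixed makes this an involution on all naturals, so
  \<open>flip_eq_iff\<close> holds without side conditions.\<close>

definition flip :: "nat \<Rightarrow> nat" where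
  "flip y = (if y = 0 then 1 else if y = 1 then 0 else y)"

lemma flip_flip: "flip (flip y) = y"
  by (simp add: flip_def)

lemma flip_eq_iff: "flip y = b \<longleftrightarrow> y = flip b"
  by (auto simp: flip_def)

lemma cond_indep_flip:
  assumes "cond_indep M A B C"
  shows "cond_indep M A (\<lambda>w. flip (B w)) C"
  unfolding cond_indep_def flip_eq_iff
  using assms unfolding cond_indep_def by blast

text \<open>Complementing Y exchanges the columns of the probability table and so reverses the sign
  of its determinant. The U found for the complemented source also serves the original one, because
  relabelling Y preserves conditional independence.\<close>

lemma Psi_xor_eq:
  fixes P :: "(nat \<times> nat) pmf"
  assumes bin: "set_pmf P \<subseteq> {0, 1} \<times> {0, 1}"
    and le: "pmf P (0, 1) * pmf P (1, 0) \<le> pmf P (0, 0) * pmf P (1, 1)"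
  shows "Psi (adjoin (\<lambda>x y. Bit_Operations.xor x y) P) = ereal (mutual_info P fst snd)"
proof (rule antisym)
  let ?P = "map_pmf (\<lambda>(x, y). (x, flip y)) P"
  have bin': "set_pmf ?P \<subseteq> {0, 1} \<times> {0, 1}"
    using bin by (auto simp: flip_def)
  have pmf': "pmf ?P (x, y) = pmf P (x, flip y)" for x y
  proof -
    have "(\<lambda>(x, y). (x, flip y)) -` {(x, y)} = {(x, flip y)}"
      by (auto simp: flip_eq_iff flip_flip)
    then show ?thesis by (simp add: pmf_map measure_pmf_single)
  qed
  have le': "pmf ?P (0, 0) * pmf ?P (1, 1) \<le> pmf ?P (0, 1) * pmf ?P (1, 0)"
    unfolding pmf' using le by (simp add: flip_def)
  obtain V :: "(nat \<times> nat \<times> nat) pmf" and p q where V: "finite (set_pmf V)" "map_pmf snd V = ?P"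
    and VU: "cond_indep V (\<lambda>(u, x, y). x) (\<lambda>(u, x, y). y) (\<lambda>(u, x, y). u)"
    and VZ: "map_pmf (\<lambda>(u, x, y). (u, x + y)) V = pair_pmf p q"
    using exists_common_information[OF bin' le'] by metis
  let ?W = "map_pmf (\<lambda>(u, x, y). (u, x, flip y)) V"
  have fin: "finite (set_pmf ?W)" using V(1) by simp
  have WP: "map_pmf snd ?W = P"
  proof -
    have "map_pmf snd ?W = map_pmf (\<lambda>(x, y). (x, flip y)) (map_pmf snd V)"
      by (simp add: map_pmf_comp split_def)
    then show ?thesis
      unfolding V(2) by (simp add: map_pmf_comp split_def flip_flip)
  qed
  have WU: "cond_indep ?W (\<lambda>(u, x, y). x) (\<lambda>(u, x, y). y) (\<lambda>(u, x, y). u)"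
    using cond_indep_flip[OF VU] unfolding cond_indep_map by (simp add: split_def)
  \<comment> \<open>Here y is the complemented bit: x + y is 1 exactly when x equals the original
    bit, that is, when the XOR is 0.\<close>
  define g :: "nat \<Rightarrow> nat" where "g z = (if z = 1 then 0 else 1)" for z
  have bv: "snd w \<in> {0, 1} \<times> {0, 1}" if "w \<in> set_pmf V" for w
  proof -
    have "snd w \<in> set_pmf (map_pmf snd V)" using that by simp
    then show ?thesis using bin' unfolding V(2) by blast
  qed
  have "map_pmf (\<lambda>(u, x, y). (u, Bit_Operations.xor x y)) ?W
      = map_pmf (\<lambda>(u, z). (u, g z)) (map_pmf (\<lambda>(u, x, y). (u, x + y)) V)"
    unfolding map_pmf_comp
  proof (intro map_pmf_cong refl)
    fix w assume "w \<in> set_pmf V"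
    from bv[OF this] show "(case case w of (u, x, y) \<Rightarrow> (u, x, flip y) of (u, x, y) \<Rightarrow> (u, Bit_Operations.xor x y))
        = (case case w of (u, x, y) \<Rightarrow> (u, x + y) of (u, z) \<Rightarrow> (u, g z))"
      by (cases w) (auto simp: flip_def g_def)
  qed
  also have "\<dots> = pair_pmf p (map_pmf g q)"
    unfolding VZ using map_pair[of "\<lambda>u. u" g p q] by simp
  finally show "ereal (mutual_info P fst snd) \<le> Psi (adjoin (\<lambda>x y. Bit_Operations.xor x y) P)"
    by (rule mutual_info_le_Psi[OF fin WP WU])
  show "Psi (adjoin (\<lambda>x y. Bit_Operations.xor x y) P) \<le> ereal (mutual_info P fst snd)"
    by (rule Psi_adjoin_le[OF finite_set_binary[OF bin]])
qed

section \<open>Positive covariance: erasing the value of AND\<close>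

text \<open>For each c, entry times total minus row sum times column sum of a 2 x 2 table is plus or
  minus its determinant, which \<open>det\<close> sets to 0.\<close>

lemma cond_indep_binary:
  fixes X Y :: "'w \<Rightarrow> nat"
  assumes bin: "\<And>w. w \<in> set_pmf M \<Longrightarrow> X w \<in> {0, 1} \<and> Y w \<in> {0, 1}"
    and det: "\<And>c. measure_pmf.prob M {w. X w = 0 \<and> Y w = 0 \<and> C w = c} * measure_pmf.prob M {w. X w = 1 \<and> Y w = 1 \<and> C w = c}
      = measure_pmf.prob M {w. X w = 0 \<and> Y w = 1 \<and> C w = c} * measure_pmf.prob M {w. X w = 1 \<and> Y w = 0 \<and> C w = c}"
  shows "cond_indep M X Y C"
  unfolding cond_indep_def
proof (intro allI)
  fix a b c
  define m where "m i j = measure_pmf.prob M {w. X w = i \<and> Y w = j \<and> C w = c}" for i j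
  have m0: "m i j = 0" if "i \<notin> {0, 1} \<or> j \<notin> {0, 1}" for i j
  proof -
    have "set_pmf M \<inter> {w. X w = i \<and> Y w = j \<and> C w = c} = {}"
    proof (rule equals0I)
      fix w assume "w \<in> set_pmf M \<inter> {w. X w = i \<and> Y w = j \<and> C w = c}"
      then show False using bin[of w] that by simp
    qed
    then show ?thesis by (simp add: m_def measure_pmf_zero_iff)
  qed
  have out: "X w \<noteq> 0 \<Longrightarrow> X w \<noteq> 1 \<Longrightarrow> pmf M w = 0" "Y w \<noteq> 0 \<Longrightarrow> Y w \<noteq> 1 \<Longrightarrow> pmf M w = 0" for w
    using bin[of w] by (auto simp: set_pmf_iff)
  have X: "measure_pmf.prob M {w. X w = i \<and> C w = c} = m i 0 + m i 1" for i
  proof -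
    have "measure_pmf.prob M {w. X w = i \<and> C w = c}
        = measure_pmf.prob M ({w. X w = i \<and> Y w = 0 \<and> C w = c} \<union> {w. X w = i \<and> Y w = 1 \<and> C w = c})"
      by (rule measure_prob_cong_0) (auto intro: out)
    also have "\<dots> = m i 0 + m i 1"
      unfolding m_def by (rule measure_pmf.finite_measure_Union) auto
    finally show ?thesis .
  qed
  have Y: "measure_pmf.prob M {w. Y w = j \<and> C w = c} = m 0 j + m 1 j" for j
  proof -
    have "measure_pmf.prob M {w. Y w = j \<and> C w = c}
        = measure_pmf.prob M ({w. X w = 0 \<and> Y w = j \<and> C w = c} \<union> {w. X w = 1 \<and> Y w = j \<and> C w = c})"
      by (rule measure_prob_cong_0) (auto intro: out)
    also have "\<dots> = m 0 j + m 1 j"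
      unfolding m_def by (rule measure_pmf.finite_measure_Union) auto
    finally show ?thesis .
  qed
  have C: "measure_pmf.prob M {w. C w = c} = m 0 0 + m 0 1 + (m 1 0 + m 1 1)"
  proof -
    have "measure_pmf.prob M {w. C w = c}
        = measure_pmf.prob M ({w. X w = 0 \<and> C w = c} \<union> {w. X w = 1 \<and> C w = c})"
      by (rule measure_prob_cong_0) (auto intro: out)
    also have "\<dots> = measure_pmf.prob M {w. X w = 0 \<and> C w = c} + measure_pmf.prob M {w. X w = 1 \<and> C w = c}"
      by (rule measure_pmf.finite_measure_Union) auto
    finally show ?thesis unfolding X .
  qed
  have d: "m 0 0 * m 1 1 = m 0 1 * m 1 0"
    using det[of c] by (simp add: m_def)
  have "m a b * (m 0 0 + m 0 1 + (m 1 0 + m 1 1)) = (m a 0 + m a 1) * (m 0 b + m 1 b)"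
  proof (cases "a \<in> {0, 1} \<and> b \<in> {0, 1}")
    case True
    then show ?thesis using d by (auto simp: algebra_simps)
  next
    case False
    then show ?thesis using m0 by auto
  qed
  then show "measure_pmf.prob M {w. X w = a \<and> Y w = b \<and> C w = c} * measure_pmf.prob M {w. C w = c}
      = measure_pmf.prob M {w. X w = a \<and> C w = c} * measure_pmf.prob M {w. Y w = b \<and> C w = c}"
    unfolding C X Y m_def[symmetric] .
qed

text \<open>By \<open>f\<close>, Z reveals whether X = Y = 1, so J can be drawn from Z. J = 1 forces
  (1,1). On J = 0 the table of \<open>P\<close> has its (1,1) entry scaled by \<epsilon>, which is
  chosen to make the determinant vanish.\<close>

lemma Psi_adjoin_eq_0:
  fixes P :: "(nat \<times> nat) pmf" and f :: "nat \<Rightarrow> nat \<Rightarrow> nat"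
  assumes bin: "set_pmf P \<subseteq> {0, 1} \<times> {0, 1}"
    and less: "pmf P (0, 1) * pmf P (1, 0) < pmf P (0, 0) * pmf P (1, 1)"
    and f: "f 0 0 \<noteq> f 1 1" "f 0 1 \<noteq> f 1 1" "f 1 0 \<noteq> f 1 1"
  shows "Psi (adjoin f P) = 0"
proof (rule antisym)
  have fin: "finite (set_pmf (adjoin f P))"
    using finite_set_binary[OF bin] by (simp add: adjoin_def)
  show "0 \<le> Psi (adjoin f P)" by (rule Psi_nonneg[OF fin])
  define \<epsilon> where "\<epsilon> = pmf P (0, 1) * pmf P (1, 0) / (pmf P (0, 0) * pmf P (1, 1))"
  have pos: "0 < pmf P (0, 0) * pmf P (1, 1)"
    using less by (rule le_less_trans[rotated]) simp
  have \<epsilon>: "0 \<le> \<epsilon>" "\<epsilon> \<le> 1" "\<epsilon> * (pmf P (0, 0) * pmf P (1, 1)) = pmf P (0, 1) * pmf P (1, 0)"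
    using pos less by (auto simp: \<epsilon>_def)
  define K where "K z = (if z = f 1 1 then ber (1 - \<epsilon>) else ber 0)" for z
  define Q where "Q = bind_pmf (adjoin f P) (\<lambda>(x, y, z). map_pmf (\<lambda>j. (x, y, z, j)) (K z))"
  have prob: "measure_pmf.prob Q {w. (case w of (x, y, z, j) \<Rightarrow> x) = a \<and> (case w of (x, y, z, j) \<Rightarrow> y) = b
      \<and> (case w of (x, y, z, j) \<Rightarrow> j) = c} = pmf P (a, b) * pmf (K (f a b)) c" for a b c
  proof -
    \<comment> \<open>Without the determined coordinate z, \<open>Q\<close> is a channel from (x, y)
      to j.\<close>
    have "bind_pmf P (\<lambda>w. map_pmf (Pair w) (K (case w of (x, y) \<Rightarrow> f x y)))
        = map_pmf (\<lambda>(x, y, z, j). ((x, y), j)) Q"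
      by (simp add: Q_def adjoin_def map_bind_pmf bind_map_pmf map_pmf_comp split_def)
    with measure_bind_channel[of P "\<lambda>w. K (case w of (x, y) \<Rightarrow> f x y)" "\<lambda>w. w" UNIV "{c}" "(a, b)"]
    have 1: "measure_pmf.prob (map_pmf (\<lambda>(x, y, z, j). ((x, y), j)) Q) {(w, j). w \<in> UNIV \<and> j \<in> {c} \<and> w = (a, b)}
        = pmf P (a, b) * pmf (K (f a b)) c"
      by (simp add: measure_pmf_single)
    have 2: "(\<lambda>(x, y, z, j). ((x, y), j)) -` {(w, j). w \<in> UNIV \<and> j \<in> {c} \<and> w = (a, b)}
        = {w. (case w of (x, y, z, j) \<Rightarrow> x) = a \<and> (case w of (x, y, z, j) \<Rightarrow> y) = b
          \<and> (case w of (x, y, z, j) \<Rightarrow> j) = c}"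
      by auto
    show ?thesis using 1 unfolding measure_map_pmf 2 .
  qed
  have "cond_indep Q (\<lambda>(x, y, z, j). x) (\<lambda>(x, y, z, j). y) (\<lambda>(x, y, z, j). j)"
  proof (rule cond_indep_binary)
    fix w assume "w \<in> set_pmf Q"
    then show "(case w of (x, y, z, j) \<Rightarrow> x) \<in> {0, 1} \<and> (case w of (x, y, z, j) \<Rightarrow> y) \<in> {0, 1}"
      using bin by (auto simp: Q_def adjoin_def)
  next
    fix c :: nat
    show "measure_pmf.prob Q {w. (case w of (x, y, z, j) \<Rightarrow> x) = 0 \<and> (case w of (x, y, z, j) \<Rightarrow> y) = 0 \<and> (case w of (x, y, z, j) \<Rightarrow> j) = c}
      * measure_pmf.prob Q {w. (case w of (x, y, z, j) \<Rightarrow> x) = 1 \<and> (case w of (x, y, z, j) \<Rightarrow> y) = 1 \<and> (case w of (x, y, z, j) \<Rightarrow> j) = c}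
      = measure_pmf.prob Q {w. (case w of (x, y, z, j) \<Rightarrow> x) = 0 \<and> (case w of (x, y, z, j) \<Rightarrow> y) = 1 \<and> (case w of (x, y, z, j) \<Rightarrow> j) = c}
      * measure_pmf.prob Q {w. (case w of (x, y, z, j) \<Rightarrow> x) = 1 \<and> (case w of (x, y, z, j) \<Rightarrow> y) = 0 \<and> (case w of (x, y, z, j) \<Rightarrow> j) = c}"
      \<comment> \<open>For c = 0 this is the defining equation of \<epsilon>. For c = 1 only the
        (1,1) entry can be nonzero, and for other c all entries are 0.\<close>
      unfolding prob using f \<epsilon> by (auto simp: K_def pmf_ber algebra_simps)
  qed
  then show "Psi (adjoin f P) \<le> 0"
    unfolding Q_def by (intro Psi_le_0[OF fin, of K]) (auto simp: K_def finite_set_ber)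
qed

text \<open>E[XY] - E[X] E[Y] is p11 - (p10 + p11)(p01 + p11); multiplying the first p11 by the
  total mass 1 leaves the determinant.\<close>

lemma covariance_binary:
  fixes P :: "(nat \<times> nat) pmf"
  assumes bin: "set_pmf P \<subseteq> {0, 1} \<times> {0, 1}"
  shows "covariance P (\<lambda>(x, y). real x) (\<lambda>(x, y). real y)
    = pmf P (0, 0) * pmf P (1, 1) - pmf P (0, 1) * pmf P (1, 0)"
proof -
  have E: "measure_pmf.expectation P g
      = g (0, 0) * pmf P (0, 0) + g (0, 1) * pmf P (0, 1) + g (1, 0) * pmf P (1, 0) + g (1, 1) * pmf P (1, 1)"
    for g :: "nat \<times> nat \<Rightarrow> real"
    using bin by (subst integral_measure_pmf_real[where A = "{0, 1} \<times> {0, 1}"])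
      (auto simp: sum.cartesian_product[symmetric])
  have a: "pmf P (0, 0) = 1 - pmf P (0, 1) - pmf P (1, 0) - pmf P (1, 1)"
    using sum_binary_pmf[OF bin] by simp
  show ?thesis
    unfolding covariance_def E by (simp add: a algebra_simps)
qed

theorem theorem2:
  fixes P_XY :: "(nat \<times> nat) pmf"
  assumes binary: "set_pmf P_XY \<subseteq> {0, 1} \<times> {0, 1}"
  shows "Psi (adjoin (\<lambda>x y. Bit_Operations.xor x y) P_XY) = ereal (mutual_info P_XY fst snd)
    \<and> (covariance P_XY (\<lambda>(x, y). real x) (\<lambda>(x, y). real y) \<le> 0 \<longrightarrow>
         Psi (adjoin (\<lambda>x y. x + y) P_XY) = ereal (mutual_info P_XY fst snd)
       \<and> Psi (adjoin (\<lambda>x y. Bit_Operations.and x y) P_XY) = ereal (mutual_info P_XY fst snd))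
    \<and> (covariance P_XY (\<lambda>(x, y). real x) (\<lambda>(x, y). real y) > 0 \<longrightarrow>
         Psi (adjoin (\<lambda>x y. x + y) P_XY) = 0
       \<and> Psi (adjoin (\<lambda>x y. Bit_Operations.and x y) P_XY) = 0)"
proof -
  note cov = covariance_binary[OF binary]
  show ?thesis
  \<comment> \<open>By \<open>cov\<close> this splits on the sign of the covariance. XOR is covered
    in both branches: as a function of X + Y in the first, through the complement of Y in the
    second.\<close>
  proof (cases "pmf P_XY (0, 0) * pmf P_XY (1, 1) \<le> pmf P_XY (0, 1) * pmf P_XY (1, 0)")
    case True
    have "Psi (adjoin (\<lambda>x y. Bit_Operations.xor x y) P_XY) = ereal (mutual_info P_XY fst snd)"
      by (rule Psi_adjoin_eq[OF binary True, where g = "\<lambda>z. if z = 1 then 1 else 0"]) auto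
    moreover have "Psi (adjoin (\<lambda>x y. x + y) P_XY) = ereal (mutual_info P_XY fst snd)"
      by (rule Psi_adjoin_eq[OF binary True, where g = "\<lambda>z. z"]) auto
    moreover have "Psi (adjoin (\<lambda>x y. Bit_Operations.and x y) P_XY) = ereal (mutual_info P_XY fst snd)"
      by (rule Psi_adjoin_eq[OF binary True, where g = "\<lambda>z. if z = 2 then 1 else 0"]) auto
    ultimately show ?thesis using True cov by simp
  next
    case False
    then have less: "pmf P_XY (0, 1) * pmf P_XY (1, 0) < pmf P_XY (0, 0) * pmf P_XY (1, 1)" by simp
    have "Psi (adjoin (\<lambda>x y. x + y) P_XY) = 0" "Psi (adjoin (\<lambda>x y. Bit_Operations.and x y) P_XY) = 0"
      by (rule Psi_adjoin_eq_0[OF binary less]; simp)+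
    then show ?thesis using less cov Psi_xor_eq[OF binary less_imp_le[OF less]] by simp
  qed
qed

end
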